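(* There is an algorithm which takes as input a $d$-degenerate graph on $n$ vertices and enumerates a dominating set of it whose size is at most $O(d^2)$ times the minimum size of a dominating set. The algorithm runs in time $n^{O(\log n)}$ and uses $O(\log^2 n)$ bits of space.
   Context: A graph is $d$-degenerate if every subgraph has a vertex of degree at most $d$. A dominating set of a graph $G=(V,E)$ is a set $S \subseteq V$ such that every vertex not in $S$ is adjacent to a vertex of $S$. Model of computation: word RAM with words of $O(\log n)$ bits; the input is read-only; output is written to a write-only stream; space is measured as the number of bits of auxiliary read-write memory used. *)

theory Defs
  imports
    Complex_Main
    "HOL-Library.Landau_Symbols"
    "HOL-Library.Discrete_Functions"
begin

section \<open>Graphs, degeneracy, domination\<close>

text \<open>Finite simple undirected graphs; edges are two-element sets of vertices.\<close>

definition simple_graph :: "'a set \<Rightarrow> 'a set set \<Rightarrow> bool" where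
  "simple_graph V E \<longleftrightarrow> finite V \<and> (\<forall>e\<in>E. \<exists>u\<in>V. \<exists>v\<in>V. u \<noteq> v \<and> e = {u, v})"

definition subgraph :: "'a set \<Rightarrow> 'a set set \<Rightarrow> 'a set \<Rightarrow> 'a set set \<Rightarrow> bool" where
  "subgraph V' E' V E \<longleftrightarrow> simple_graph V' E' \<and> V' \<subseteq> V \<and> E' \<subseteq> E"

definition degree :: "'a set set \<Rightarrow> 'a \<Rightarrow> nat" where
  "degree E v = card {e \<in> E. v \<in> e}"

text \<open>The empty subgraph has no vertex at all and has to be excluded.\<close>

definition degenerate :: "nat \<Rightarrow> 'a set \<Rightarrow> 'a set set \<Rightarrow> bool" where
  "degenerate d V E \<longleftrightarrow>
     (\<forall>V' E'. subgraph V' E' V E \<and> V' \<noteq> {} \<longrightarrow> (\<exists>v\<in>V'. degree E' v \<le> d))"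

definition dominating_set :: "'a set \<Rightarrow> 'a set set \<Rightarrow> 'a set \<Rightarrow> bool" where
  "dominating_set V E S \<longleftrightarrow> S \<subseteq> V \<and> (\<forall>v\<in>V - S. \<exists>u\<in>S. {u, v} \<in> E)"

definition domination_number :: "'a set \<Rightarrow> 'a set set \<Rightarrow> nat" where
  "domination_number V E = Min (card ` {S. dominating_set V E S})"


section \<open>The word RAM\<close>

text \<open>
  A program is a fixed list of instructions, run with a word length \<open>w\<close>. The working memory
  is an array of \<open>w\<close>-bit words, initially zero; there are no registers besides it, so that
  all read-write storage is charged for. The operands \<open>a\<close>, \<open>b\<close>, \<open>c\<close> below are constant
  addresses of working memory cells; \<open>Load\<close> and \<open>Store\<close> provide indirect addressing.
  The input is an array of words that can only be read (\<open>Read\<close> uses the content of a cell as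
  index into it), and the output is a stream to which words can only be appended.
\<close>

datatype binop = Add | Sub | Mul | Div | Mod | And | Or | Xor | Shl | Shr

datatype instr =
    Const nat nat            \<comment> \<open>\<open>Const a k\<close>: \<open>M[a] := k\<close>\<close>
  | Op binop nat nat nat     \<comment> \<open>\<open>Op f a b c\<close>: \<open>M[a] := f M[b] M[c]\<close>\<close>
  | Load nat nat             \<comment> \<open>\<open>Load a b\<close>: \<open>M[a] := M[M[b]]\<close>\<close>
  | Store nat nat            \<comment> \<open>\<open>Store a b\<close>: \<open>M[M[a]] := M[b]\<close>\<close>
  | Read nat nat             \<comment> \<open>\<open>Read a b\<close>: \<open>M[a] := input[M[b]]\<close>\<close>
  | Write nat                \<comment> \<open>\<open>Write a\<close>: append \<open>M[a]\<close> to the output\<close>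
  | Jump nat
  | JumpZero nat nat         \<comment> \<open>\<open>JumpZero a l\<close>: jump to \<open>l\<close> if \<open>M[a] = 0\<close>\<close>
  | JumpLess nat nat nat     \<comment> \<open>\<open>JumpLess a b l\<close>: jump to \<open>l\<close> if \<open>M[a] < M[b]\<close>\<close>

type_synonym program = "instr list"

record config =
  pc :: nat
  mem :: "nat \<Rightarrow> nat"
  out :: "nat list"

text \<open>Results are reduced modulo \<open>2 ^ w\<close> when they are stored; subtraction wraps around.\<close>

fun binop_val :: "nat \<Rightarrow> binop \<Rightarrow> nat \<Rightarrow> nat \<Rightarrow> nat" where
  "binop_val w Add x y = x + y"
| "binop_val w Sub x y = x + (2 ^ w - y)"
| "binop_val w Mul x y = x * y"
| "binop_val w Div x y = x div y"
| "binop_val w Mod x y = x mod y"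
| "binop_val w And x y = Bit_Operations.and x y"
| "binop_val w Or x y = Bit_Operations.or x y"
| "binop_val w Xor x y = Bit_Operations.xor x y"
| "binop_val w Shl x y = push_bit y x"
| "binop_val w Shr x y = drop_bit y x"

definition set_cell :: "nat \<Rightarrow> nat \<Rightarrow> nat \<Rightarrow> config \<Rightarrow> config" where
  "set_cell w a x c = c\<lparr>pc := Suc (pc c), mem := (mem c)(a := x mod 2 ^ w)\<rparr>"

definition input_word :: "nat list \<Rightarrow> nat \<Rightarrow> nat" where
  "input_word xs i = (if i < length xs then xs ! i else 0)"

fun exec :: "nat \<Rightarrow> nat list \<Rightarrow> instr \<Rightarrow> config \<Rightarrow> config" where
  "exec w xs (Const a k) s = set_cell w a k s"
| "exec w xs (Op f a b c) s = set_cell w a (binop_val w f (mem s b) (mem s c)) s"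
| "exec w xs (Load a b) s = set_cell w a (mem s (mem s b)) s"
| "exec w xs (Store a b) s = set_cell w (mem s a) (mem s b) s"
| "exec w xs (Read a b) s = set_cell w a (input_word xs (mem s b)) s"
| "exec w xs (Write a) s = s\<lparr>pc := Suc (pc s), out := out s @ [mem s a]\<rparr>"
| "exec w xs (Jump l) s = s\<lparr>pc := l\<rparr>"
| "exec w xs (JumpZero a l) s = s\<lparr>pc := (if mem s a = 0 then l else Suc (pc s))\<rparr>"
| "exec w xs (JumpLess a b l) s = s\<lparr>pc := (if mem s a < mem s b then l else Suc (pc s))\<rparr>"

text \<open>The addresses of the working memory cells that an instruction reads or writes.\<close>

fun touched :: "instr \<Rightarrow> config \<Rightarrow> nat set" where
  "touched (Const a k) s = {a}"
| "touched (Op f a b c) s = {a, b, c}"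
| "touched (Load a b) s = {a, b, mem s b}"
| "touched (Store a b) s = {a, b, mem s a}"
| "touched (Read a b) s = {a, b}"
| "touched (Write a) s = {a}"
| "touched (Jump l) s = {}"
| "touched (JumpZero a l) s = {a}"
| "touched (JumpLess a b l) s = {a, b}"

definition halted :: "program \<Rightarrow> config \<Rightarrow> bool" where
  "halted P s \<longleftrightarrow> pc s \<ge> length P"

definition step :: "program \<Rightarrow> nat \<Rightarrow> nat list \<Rightarrow> config \<Rightarrow> config" where
  "step P w xs s = (if halted P s then s else exec w xs (P ! pc s) s)"

definition run :: "program \<Rightarrow> nat \<Rightarrow> nat list \<Rightarrow> nat \<Rightarrow> config" where
  "run P w xs t = (step P w xs ^^ t) \<lparr>pc = 0, mem = (\<lambda>_. 0), out = []\<rparr>"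

definition cells_used :: "program \<Rightarrow> nat \<Rightarrow> nat list \<Rightarrow> nat \<Rightarrow> nat set" where
  "cells_used P w xs t = (\<Union>i<t. touched (P ! pc (run P w xs i)) (run P w xs i))"

text \<open>
  On input \<open>xs\<close> the program halts after exactly \<open>t\<close> steps with output \<open>ys\<close>, having used
  \<open>b\<close> bits of working memory. Space is charged for the whole initial segment of the memory up
  to the largest address in use, so that nothing is gained from a sparse use of the memory.
\<close>

definition computes :: "program \<Rightarrow> nat \<Rightarrow> nat list \<Rightarrow> nat list \<Rightarrow> nat \<Rightarrow> nat \<Rightarrow> bool" where
  "computes P w xs ys t b \<longleftrightarrow>
     halted P (run P w xs t) \<and> (\<forall>i<t. \<not> halted P (run P w xs i)) \<and>
     out (run P w xs t) = ys \<and>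
     b = w * (LEAST m. cells_used P w xs t \<subseteq> {..<m})"

text \<open>
  Words of \<open>O(log n)\<close> bits: a constant multiple of the length of the binary representation
  of \<open>n\<close>. The factor depends on the program only.
\<close>

definition word_length :: "nat \<Rightarrow> nat \<Rightarrow> nat" where
  "word_length k n = k * (floor_log n + 1)"

text \<open>
  A graph with vertices \<open>0, \<dots>, n - 1\<close> is given by \<open>n\<close> followed by its adjacency matrix,
  row by row.
\<close>

definition graph_input :: "nat \<Rightarrow> nat set set \<Rightarrow> nat list" where
  "graph_input n E = n # [of_bool ({u, v} \<in> E). u \<leftarrow> [0..<n], v \<leftarrow> [0..<n]]"

end

(*
  A parallel primal-dual method. Every vertex u carries a dual value pk r u, initially 1. In round r
  a vertex is heavy if the values in its closed neighbourhood sum to at least n, and the values of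
  all vertices without a heavy neighbour are doubled. No neighbourhood ever exceeds 2 n, so that the
  final values bound the domination number from below by weak duality, and after about log n rounds
  every vertex is dominated. Each vertex u selects one heavy neighbour sel u in the round in which
  it is dominated. Orient the edges with outdegree at most d. A selected vertex is either selected
  by some u with value at least n / (2 d), or all values are then so small that its at most d
  out-neighbours contribute less than n / 2 to its sum, and its in-neighbours pay for it. Either way
  the number of selected vertices is O(d) times the domination number.

  The value of a vertex after r rounds is found by a recursion of depth O(log n) with branching
  n^2, whose stack frames have a constant number of words.
*)
theory Submission
  imports Defs "HOL-Real_Asymp.Real_Asymp"
begin

section \<open>Doubling dual values\<close>

locale graph =
  fixes n :: nat and E :: "nat set set"
  assumes simple: "simple_graph {..<n} E"
begin

definition nb :: "nat \<Rightarrow> nat set" where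
  "nb v = {w. w < n \<and> (w = v \<or> {v, w} \<in> E)}"

primrec pk :: "nat \<Rightarrow> nat \<Rightarrow> nat" where
  "pk 0 u = 1"
| "pk (Suc r) u = (if \<exists>v\<in>nb u. n \<le> (\<Sum>w\<in>nb v. pk r w) then pk r u else 2 * pk r u)"

definition load :: "nat \<Rightarrow> nat \<Rightarrow> nat" where
  "load r v = (\<Sum>w\<in>nb v. pk r w)"

definition hit :: "nat \<Rightarrow> nat \<Rightarrow> bool" where
  "hit r u \<longleftrightarrow> (\<exists>v\<in>nb u. n \<le> load r v)"

definition fst_hit :: "nat \<Rightarrow> nat" where
  "fst_hit u = (LEAST r. hit r u)"

definition sel :: "nat \<Rightarrow> nat" where
  "sel u = (LEAST v. v \<in> nb u \<and> n \<le> load (fst_hit u) v)"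

lemma finite_nb [simp]: "finite (nb v)"
  by (simp add: nb_def)

lemma edge_less: "{v, w} \<in> E \<Longrightarrow> v < n \<and> w < n"
  using simple unfolding simple_graph_def by (metis doubleton_eq_iff lessThan_iff)

lemma nb_less: "w \<in> nb v \<Longrightarrow> v < n \<and> w < n"
  by (auto simp: nb_def dest: edge_less)

lemma nb_sym: "w \<in> nb v \<Longrightarrow> v \<in> nb w"
  using nb_less[of w v] by (auto simp: nb_def insert_commute)

lemma nb_self: "v < n \<Longrightarrow> v \<in> nb v"
  by (simp add: nb_def)

lemma pk_Suc: "pk (Suc r) u = (if hit r u then pk r u else 2 * pk r u)"
  by (simp add: hit_def load_def)

lemma pk_mono: "r \<le> s \<Longrightarrow> pk r u \<le> pk s u"
  by (induction s rule: dec_induct) (auto intro: order_trans)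

lemma load_mono: "r \<le> s \<Longrightarrow> load r v \<le> load s v"
  unfolding load_def by (intro sum_mono pk_mono)

lemma hit_mono: "hit r u \<Longrightarrow> r \<le> s \<Longrightarrow> hit s u"
  unfolding hit_def using load_mono order_trans by blast

lemma pk_le_power: "pk r u \<le> 2 ^ r"
  by (induction r) auto

lemma pk_unhit: "(\<And>s. s < r \<Longrightarrow> \<not> hit s u) \<Longrightarrow> pk r u = 2 ^ r"
  by (induction r) (simp_all add: pk_Suc del: pk.simps(2))

lemma pk_hit: "hit s u \<Longrightarrow> s \<le> r \<Longrightarrow> pk r u = pk s u"
  by (induction r rule: nat_induct) (auto simp: pk_Suc le_Suc_eq dest: hit_mono simp del: pk.simps(2))

text \<open>Once \<open>v\<close> is heavy, symmetry of closed neighbourhoods freezes every value in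
  \<open>nb v\<close>, and with them the load. A load still below \<open>n\<close> can at most
  double. The initial load counts vertices.\<close>

lemma load_le: "load r v \<le> 2 * n"
proof (induction r)
  case 0
  have "card (nb v) \<le> card {..<n}" by (rule card_mono) (auto simp: nb_def)
  then show ?case by (simp add: load_def)
next
  case (Suc r)
  show ?case
  proof (cases "n \<le> load r v")
    case True
    then have "hit r w" if "w \<in> nb v" for w
      using nb_sym[OF that] by (auto simp: hit_def)
    then have "load (Suc r) v = load r v"
      unfolding load_def by (intro sum.cong) (auto simp: pk_Suc simp del: pk.simps(2))
    then show ?thesis using Suc by simp
  next
    case False
    have "load (Suc r) v \<le> (\<Sum>w\<in>nb v. 2 * pk r w)"
      unfolding load_def by (rule sum_mono) simp
    also have "\<dots> = 2 * load r v" by (simp add: load_def sum_distrib_left)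
    finally show ?thesis using False by linarith
  qed
qed

lemma pk_le_load: "u \<in> nb v \<Longrightarrow> pk r u \<le> load r v"
  unfolding load_def by (rule member_le_sum) auto

lemma pk_le: "u < n \<Longrightarrow> pk r u \<le> 2 * n"
  using pk_le_load[of u u r] load_le[of r u] by (simp add: nb_self)

text \<open>A vertex not hit by round \<open>r\<close> was doubled every time, so its own value
  \<open>2 ^ r\<close> already makes its neighbourhood heavy. Hence logarithmically many rounds
  suffice.\<close>

lemma hit_large:
  assumes "u < n" "n \<le> 2 ^ r"
  shows "hit r u"
proof (rule ccontr)
  assume a: "\<not> hit r u"
  then have "pk r u = 2 ^ r"
    by (intro pk_unhit) (meson hit_mono less_imp_le)
  then have "n \<le> load r u"
    using pk_le_load[OF nb_self[OF assms(1)], of r] assms(2) by simp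
  then show False using a nb_self[OF assms(1)] by (auto simp: hit_def)
qed

lemma fst_hit_le: "hit r u \<Longrightarrow> fst_hit u \<le> r"
  unfolding fst_hit_def by (rule Least_le)

lemma hit_fst_hit: "u < n \<Longrightarrow> hit (fst_hit u) u"
  \<comment> \<open>Any late enough round is a witness; round \<open>n\<close> is one since
    \<open>n \<le> 2 ^ n\<close>.\<close>
  unfolding fst_hit_def by (rule LeastI[of _ n]) (auto intro!: hit_large simp: less_imp_le)

lemma not_hit_before: "r < fst_hit u \<Longrightarrow> \<not> hit r u"
  using fst_hit_le leD by blast

lemma pk_fst_hit: "pk (fst_hit u) u = 2 ^ fst_hit u"
  by (rule pk_unhit) (rule not_hit_before)

lemma pk_final: "u < n \<Longrightarrow> fst_hit u \<le> r \<Longrightarrow> pk r u = 2 ^ fst_hit u"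
  using pk_hit[OF hit_fst_hit] pk_fst_hit by metis

lemma pk_le_final: "u < n \<Longrightarrow> pk r u \<le> 2 ^ fst_hit u"
  \<comment> \<open>Values only grow, so the comparison is made in a round past both
    \<open>r\<close> and the freezing of \<open>u\<close>.\<close>
  using pk_mono[of r "max r (fst_hit u)" u] pk_final[of u "max r (fst_hit u)"] by simp

lemma sel_props:
  assumes "u < n"
  shows "sel u \<in> nb u" "n \<le> load (fst_hit u) (sel u)"
proof -
  obtain v where "v \<in> nb u \<and> n \<le> load (fst_hit u) v"
    using hit_fst_hit[OF assms] by (auto simp: hit_def)
  then have "sel u \<in> nb u \<and> n \<le> load (fst_hit u) (sel u)"
    unfolding sel_def by (rule LeastI)
  then show "sel u \<in> nb u" "n \<le> load (fst_hit u) (sel u)" by auto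
qed

text \<open>By round \<open>n\<close> all values are frozen, so this sum is a load and
  \<open>load_le\<close> applies.\<close>

lemma sum_final_le: "(\<Sum>w\<in>nb v. 2 ^ fst_hit w) \<le> 2 * n"
proof -
  have "fst_hit w \<le> n" if "w \<in> nb v" for w
    using that by (intro fst_hit_le hit_large) (auto simp: nb_def less_imp_le)
  then have "(\<Sum>w\<in>nb v. 2 ^ fst_hit w) = load n v"
    unfolding load_def by (intro sum.cong) (auto simp: nb_def pk_final)
  then show ?thesis using load_le by simp
qed

text \<open>Weak duality for the fractional relaxation, the dual values being scaled by \<open>2 n\<close>.\<close>

lemma sum_final_le_dominating:
  assumes "dominating_set {..<n} E D"
  shows "(\<Sum>u<n. 2 ^ fst_hit u) \<le> 2 * n * card D"
proof -
  have fD: "finite D" using assms finite_subset by (auto simp: dominating_set_def)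
  have "{..<n} \<subseteq> (\<Union>v\<in>D. nb v)"
  proof
    fix u assume u: "u \<in> {..<n}"
    show "u \<in> (\<Union>v\<in>D. nb v)"
    proof (cases "u \<in> D")
      case True then show ?thesis using u nb_self by auto
    next
      case False
      then obtain v where "v \<in> D" "{v, u} \<in> E" using assms u by (auto simp: dominating_set_def)
      then show ?thesis using u by (auto simp: nb_def)
    qed
  qed
  then have "(\<Sum>u<n. 2 ^ fst_hit u) \<le> (\<Sum>u\<in>(\<Union>v\<in>D. nb v). (2::nat) ^ fst_hit u)"
    using fD by (intro sum_mono2) auto
  \<comment> \<open>A union bound, by induction on \<open>D\<close>: dropping the intersection term
    of \<open>sum.union_inter\<close> leaves subadditivity.\<close>
  also have "\<dots> \<le> (\<Sum>v\<in>D. \<Sum>w\<in>nb v. 2 ^ fst_hit w)"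
    using fD by (induction D rule: finite_induct) (auto intro!: order_trans[OF sum.union_inter[THEN eq_refl, THEN add_leD1]])
  also have "\<dots> \<le> (\<Sum>v\<in>D. 2 * n)" by (intro sum_mono sum_final_le)
  finally show ?thesis by (simp add: mult.commute)
qed

lemma dominating_sel: "dominating_set {..<n} E (sel ` {..<n})"
  unfolding dominating_set_def
proof (intro conjI ballI)
  show "sel ` {..<n} \<subseteq> {..<n}" using sel_props(1) nb_less by blast
next
  fix v assume v: "v \<in> {..<n} - sel ` {..<n}"
  then have "sel v \<in> nb v" "sel v \<noteq> v" using sel_props(1)[of v] by (auto simp: image_iff dest: bspec[of _ _ v])
  then have "{sel v, v} \<in> E" by (auto simp: nb_def insert_commute)
  then show "\<exists>u\<in>sel ` {..<n}. {u, v} \<in> E" using v by blast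
qed

end


section \<open>Orientations of degenerate graphs\<close>

text \<open>Peel off a vertex of degree at most \<open>d\<close> and direct all its edges away from
  it; the remaining edges are oriented by induction.\<close>

lemma degenerate_orientation:
  fixes V :: "'a set"
  assumes "simple_graph V E" "degenerate d V E"
  shows "\<exists>out. (\<forall>u. finite (out u) \<and> card (out u) \<le> d) \<and>
    (\<forall>u v. {u, v} \<in> E \<longrightarrow> v \<in> out u \<or> u \<in> out v)"
proof -
  have *: "\<exists>out. (\<forall>u. finite (out u) \<and> card (out u) \<le> d) \<and>
    (\<forall>u\<in>V'. \<forall>v\<in>V'. {u, v} \<in> E \<longrightarrow> v \<in> out u \<or> u \<in> out v)"
    if "finite V'" "V' \<subseteq> V" for V'
    using that
  proof (induction "card V'" arbitrary: V')
    case 0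
    then have "V' = {}" by simp
    then show ?case by (intro exI[of _ "\<lambda>_. {}"]) simp
  next
    case (Suc k)
    \<comment> \<open>The induced subgraph, so that the degree counts all neighbours still
      present.\<close>
    define E' where "E' = {e \<in> E. e \<subseteq> V'}"
    have "simple_graph V' E'"
      using assms(1) Suc.prems unfolding simple_graph_def E'_def by fastforce
    then have "subgraph V' E' V E" using Suc.prems by (auto simp: subgraph_def E'_def)
    moreover have "V' \<noteq> {}" using Suc.hyps by auto
    ultimately obtain v where v: "v \<in> V'" "degree E' v \<le> d"
      using assms(2) unfolding degenerate_def by blast
    have c: "k = card (V' - {v})" using Suc v by simp
    have "finite (V' - {v})" "V' - {v} \<subseteq> V" using Suc.prems by auto
    from Suc.hyps(1)[OF c this] obtain out where
      out: "\<forall>u. finite (out u) \<and> card (out u) \<le> d"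
        "\<forall>u\<in>V'-{v}. \<forall>x\<in>V'-{v}. {u, x} \<in> E \<longrightarrow> x \<in> out u \<or> u \<in> out x" by blast
    define N where "N = {x \<in> V'. {v, x} \<in> E}"
    \<comment> \<open>Distinct neighbours of \<open>v\<close> give distinct edges at
      \<open>v\<close>, so \<open>N\<close> is no larger than its degree.\<close>
    have "inj_on (\<lambda>x. {v, x}) N" by (rule inj_onI) (auto simp: doubleton_eq_iff)
    moreover have "(\<lambda>x. {v, x}) ` N \<subseteq> {e \<in> E'. v \<in> e}" using v by (auto simp: N_def E'_def)
    moreover have "finite {e \<in> E'. v \<in> e}"
      by (rule finite_subset[of _ "Pow V'"]) (use Suc.prems in \<open>auto simp: E'_def\<close>)
    ultimately have "card N \<le> degree E' v" unfolding degree_def by (rule card_inj_on_le)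
    then have N: "finite N" "card N \<le> d" using v Suc.prems by (auto simp: N_def)
    have nl: "{v, v} \<notin> E" using assms(1) by (fastforce simp: simple_graph_def doubleton_eq_iff)
    show ?case
    proof (intro exI[of _ "out(v := N)"] conjI allI ballI impI)
      fix u x assume a: "u \<in> V'" "x \<in> V'" "{u, x} \<in> E"
      consider "u = v" | "x = v" | "u \<noteq> v" "x \<noteq> v" by blast
      then show "x \<in> (out(v := N)) u \<or> u \<in> (out(v := N)) x"
      proof cases
        case 1 then show ?thesis using a by (auto simp: N_def)
      next
        case 2 then show ?thesis using a by (auto simp: N_def insert_commute)
      next
        case 3 then show ?thesis using a out by auto
      qed
    qed (use out N in auto)
  qed
  have "finite V" using assms(1) by (simp add: simple_graph_def)
  from *[OF this order_refl] obtain out where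
    out: "\<forall>u. finite (out u) \<and> card (out u) \<le> d"
     "\<forall>u\<in>V. \<forall>v\<in>V. {u, v} \<in> E \<longrightarrow> v \<in> out u \<or> u \<in> out v" by blast
  have "u \<in> V \<and> v \<in> V" if "{u, v} \<in> E" for u v
    using assms(1) that unfolding simple_graph_def by (metis doubleton_eq_iff)
  then show ?thesis using out by blast
qed

section \<open>The approximation ratio\<close>

context graph
begin

text \<open>The summand \<open>4 * d\<close> bounds the selecting vertices of large value, which are
  few because the total value is at most \<open>2 * n * card D\<close>. The summand
  \<open>4 * (d + 1)\<close> bounds the vertices selected by the others: each is charged
  \<open>n / 2\<close> to final values, and every value is charged at most \<open>d + 1\<close>
  times.\<close>

lemma card_sel_le:
  assumes deg: "degenerate d {..<n} E" and D: "dominating_set {..<n} E D"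
  shows "card (sel ` {..<n}) \<le> (8 * d + 4) * card D"
proof (cases "n = 0")
  case False
  define y :: "nat \<Rightarrow> nat" where "y u = 2 ^ fst_hit u" for u
  have tot: "(\<Sum>u<n. y u) \<le> 2 * n * card D"
    unfolding y_def by (rule sum_final_le_dominating[OF D])
  obtain out where out: "\<And>u. finite (out u)" "\<And>u. card (out u) \<le> d"
    "\<And>u v. {u, v} \<in> E \<Longrightarrow> v \<in> out u \<or> u \<in> out v"
    using degenerate_orientation[OF simple deg] by blast
  \<comment> \<open>The threshold \<open>n / (2 d)\<close> is cleared of its denominator, which also
    covers \<open>d = 0\<close>.\<close>
  define A where "A = {u. u < n \<and> n \<le> 2 * d * y u}"
  define B where "B = {u. u < n \<and> 2 * d * y u < n}"
  have "n * card A \<le> (\<Sum>u\<in>A. 2 * d * y u)"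
    using sum_bounded_below[of A n "\<lambda>u. 2 * d * y u"] by (auto simp: A_def mult.commute)
  also have "\<dots> \<le> (\<Sum>u<n. 2 * d * y u)" by (intro sum_mono2) (auto simp: A_def)
  also have "\<dots> = 2 * d * (\<Sum>u<n. y u)" by (simp add: sum_distrib_left)
  also have "\<dots> \<le> 2 * d * (2 * n * card D)" using tot by (rule mult_left_mono) simp
  finally have "n * card A \<le> n * (4 * d * card D)" by (simp add: algebra_simps)
  then have "card A \<le> 4 * d * card D" using False by simp
  moreover have "card (sel ` A) \<le> card A" by (rule card_image_le) (simp add: A_def)
  ultimately have cA: "card (sel ` A) \<le> 4 * d * card D" by linarith
  define into where "into v = {w. w < n \<and> (w = v \<or> v \<in> out w)}" for v
  \<comment> \<open>In round \<open>fst_hit u\<close> no value exceeds \<open>2 ^ fst_hit u\<close>,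
    which is \<open>y u\<close>. So \<open>out v\<close> carries less than \<open>n / 2\<close> of a
    load that is at least \<open>n\<close>, and the rest lies in \<open>into v\<close>.\<close>
  have low: "n \<le> 2 * (\<Sum>w\<in>into v. y w)" if v: "v \<in> sel ` B" for v
  proof -
    obtain u where u: "u < n" "2 * d * y u < n" "v = sel u" using v by (auto simp: B_def)
    let ?r = "fst_hit u"
    \<comment> \<open>Only an inclusion, since \<open>out\<close> may also contain
      non-neighbours.\<close>
    have "nb v \<subseteq> into v \<union> out v" using out(3) by (auto simp: nb_def into_def)
    then have "load ?r v \<le> (\<Sum>w\<in>into v \<union> out v. pk ?r w)"
      unfolding load_def using out(1) by (intro sum_mono2) (auto simp: into_def)
    also have "\<dots> \<le> (\<Sum>w\<in>into v. pk ?r w) + (\<Sum>w\<in>out v. pk ?r w)"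
      using out(1) by (subst sum_Un_nat) (auto simp: into_def)
    also have "(\<Sum>w\<in>into v. pk ?r w) \<le> (\<Sum>w\<in>into v. y w)"
      unfolding y_def by (intro sum_mono pk_le_final) (simp add: into_def)
    also have "(\<Sum>w\<in>out v. pk ?r w) \<le> card (out v) * y u"
      using sum_bounded_above[of "out v" "pk ?r" "y u"] pk_le_power by (simp add: y_def)
    also have "\<dots> \<le> d * y u" using out(2) by simp
    finally have "load ?r v \<le> (\<Sum>w\<in>into v. y w) + d * y u" by simp
    then show ?thesis using sel_props(2)[OF u(1)] u by simp
  qed
  have "n * card (sel ` B) \<le> (\<Sum>v\<in>sel ` B. 2 * (\<Sum>w\<in>into v. y w))"
    using sum_bounded_below[of "sel ` B" n, OF low] by (simp add: mult.commute)
  also have "\<dots> \<le> (\<Sum>v<n. 2 * (\<Sum>w\<in>into v. y w))"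
    using sel_props(1) nb_less by (intro sum_mono2) (auto simp: B_def)
  also have "\<dots> = 2 * (\<Sum>v<n. \<Sum>w\<in>{w\<in>{..<n}. w = v \<or> v \<in> out w}. y w)"
    by (simp add: sum_distrib_left into_def)
  \<comment> \<open>Double counting: \<open>w\<close> pays for itself and for the members of
    \<open>out w\<close>.\<close>
  also have "(\<Sum>v<n. \<Sum>w\<in>{w\<in>{..<n}. w = v \<or> v \<in> out w}. y w)
      = (\<Sum>w<n. \<Sum>v\<in>{v\<in>{..<n}. w = v \<or> v \<in> out w}. y w)"
    by (rule sum.swap_restrict) auto
  also have "\<dots> \<le> (\<Sum>w<n. (d + 1) * y w)"
  proof (rule sum_mono)
    fix w
    have "card {v\<in>{..<n}. w = v \<or> v \<in> out w} \<le> card (insert w (out w))"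
      using out(1) by (intro card_mono) auto
    also have "\<dots> \<le> d + 1" using out(1,2)[of w] by (simp add: card_insert_if)
    finally show "(\<Sum>v\<in>{v\<in>{..<n}. w = v \<or> v \<in> out w}. y w) \<le> (d + 1) * y w" 
      by (simp only: sum_constant mult_right_mono of_nat_id)
  qed
  also have "\<dots> = (d + 1) * (\<Sum>w<n. y w)" by (simp only: sum_distrib_left)
  also have "\<dots> \<le> (d + 1) * (2 * n * card D)" using tot by (rule mult_left_mono) simp
  finally have "n * card (sel ` B) \<le> n * (4 * (d + 1) * card D)" by (simp add: algebra_simps)
  then have cB: "card (sel ` B) \<le> 4 * (d + 1) * card D" using False by simp
  have "{..<n} = A \<union> B" by (auto simp: A_def B_def)
  then have "sel ` {..<n} = sel ` A \<union> sel ` B" by (metis image_Un)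
  then have "card (sel ` {..<n}) \<le> card (sel ` A) + card (sel ` B)" by (simp add: card_Un_le)
  also have "\<dots> \<le> (8 * d + 4) * card D" using cA cB by (simp add: algebra_simps)
  finally show ?thesis .
qed simp

lemma card_sel_le_domination_number:
  assumes "degenerate d {..<n} E"
  shows "card (sel ` {..<n}) \<le> (8 * d + 4) * domination_number {..<n} E"
proof -
  let ?S = "{S. dominating_set {..<n} E S}"
  have "?S \<subseteq> Pow {..<n}" by (auto simp: dominating_set_def)
  then have "finite ?S" using finite_subset by blast
  then have "domination_number {..<n} E \<in> card ` ?S"
    unfolding domination_number_def using dominating_sel by (intro Min_in) auto
  then show ?thesis using card_sel_le[OF assms] by auto
qed

end


section \<open>The program\<close>

text \<open>
  The procedure at 9 to 66 computes \<open>pk R u\<close> by searching the first \<open>r < R\<close>, and for it the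
  first \<open>v\<close>, that dominates \<open>u\<close>; so it also leaves \<open>sel u\<close> in the register of \<open>v\<close>. It calls itself
  at 33 to 43 for the values \<open>pk r w\<close> that make up \<open>load r v\<close>, and since \<open>r\<close> and \<open>w\<close> become the
  arguments \<open>R\<close> and \<open>u\<close> of the callee, they need not be saved. An empty stack tells it (at 45) to
  return to the main loop, which asks for each \<open>a\<close> whether \<open>a = sel u\<close> for some \<open>u\<close>; the bound
  \<open>R = n\<close> used there is large enough never to be reached.
\<close>

definition prog :: program where
  "prog = [
    Const 2 1, Read 3 11, Const 13 14,
    JumpLess 4 3 5, Jump 74, Const 5 0,
    JumpLess 5 3 8, Jump 72, Op Or 6 3 3,
    Const 7 0,
    JumpLess 7 6 12, Jump 61, Const 8 0,
    JumpLess 8 3 15, Jump 65,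
    Op Xor 11 5 8, JumpZero 11 22,
    Op Mul 11 5 3, Op Add 11 11 8, Op Add 11 11 2, Read 11 11, JumpZero 11 63,
    Const 10 0, Const 9 0,
    JumpLess 9 3 26, Jump 60,
    Op Xor 11 8 9, JumpZero 11 33,
    Op Mul 11 8 3, Op Add 11 11 9, Op Add 11 11 2, Read 11 11, JumpZero 11 58,
    Store 13 6, Op Add 13 13 2, Store 13 5, Op Add 13 13 2,
    Store 13 8, Op Add 13 13 2, Store 13 10, Op Add 13 13 2,
    Op Or 6 7 7, Op Or 5 9 9, Jump 9,
    Const 11 14, JumpLess 11 13 47, Jump 67,
    Op Or 7 6 6, Op Or 9 5 5,
    Op Sub 13 13 2, Load 10 13, Op Sub 13 13 2, Load 8 13,
    Op Sub 13 13 2, Load 5 13, Op Sub 13 13 2, Load 6 13,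
    Op Add 10 10 12,
    Op Add 9 9 2, Jump 24,
    JumpLess 10 3 63,
    Op Shl 12 2 7, Jump 44,
    Op Add 8 8 2, Jump 13,
    Op Add 7 7 2, Jump 10,
    Op Xor 11 8 4, JumpZero 11 71, Op Add 5 5 2, Jump 6,
    Write 4, Op Add 4 4 2, Jump 3]"

lemma length_prog: "length prog = 74"
  by (simp add: prog_def)


section \<open>Running time\<close>

text \<open>Here \<open>d\<close> is the number of rounds that a call may search. The call recurs on
  all smaller bounds, but consecutive costs differ just by the price of one more round, so
  structural recursion suffices; \<open>call_cost_eq\<close> recovers the sum.\<close>

fun call_cost :: "nat \<Rightarrow> nat \<Rightarrow> nat" where
  "call_cost n 0 = 10"
| "call_cost n (Suc d) = call_cost n d + (10 + n * (22 + n * (40 + call_cost n d)))"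

definition run_cost :: "nat \<Rightarrow> nat \<Rightarrow> nat" where
  "run_cost n d = 7 + n * (10 + n * (20 + call_cost n d))"

lemma call_cost_eq: "call_cost n d = 10 + (\<Sum>i<d. 10 + n * (22 + n * (40 + call_cost n i)))"
  by (induction d) auto

lemma call_cost_mono: "i \<le> j \<Longrightarrow> call_cost n i \<le> call_cost n j"
  by (induction j rule: dec_induct) auto

text \<open>The shift by 40 makes one level of the recurrence a mere multiplication by at most
  \<open>2 * (n + 1)\<^sup>2\<close>.\<close>

lemma call_cost_le: "call_cost n d + 40 \<le> 50 * (2 * (n + 1)\<^sup>2) ^ d"
proof (induction d)
  case (Suc d)
  have "call_cost n (Suc d) + 40 \<le> (call_cost n d + 40) * (2 * (n + 1)\<^sup>2)"
    by (simp add: algebra_simps power2_eq_square)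
  also have "\<dots> \<le> 50 * (2 * (n + 1)\<^sup>2) ^ d * (2 * (n + 1)\<^sup>2)"
    using Suc by (rule mult_right_mono) simp
  finally show ?case by (simp only: power_Suc mult_ac)
qed simp

text \<open>Each level of the recursion is absorbed by \<open>n ^ 5\<close>. The three remaining
  factors \<open>n\<close> stand for the loops over \<open>a\<close> and \<open>u\<close> and for
  the constant 50.\<close>

lemma run_cost_le:
  assumes "50 \<le> n"
  shows "run_cost n d \<le> n ^ (5 * d + 3)"
proof -
  have "2 * (n + 1)\<^sup>2 \<le> 2 * (2 * n)\<^sup>2" using assms by (intro mult_left_mono power_mono) auto
  also have "\<dots> = 8 * n\<^sup>2" by (simp add: power_mult_distrib)
  also have "\<dots> \<le> n ^ 3 * n\<^sup>2" using power_mono[of 2 n 3] assms by (intro mult_right_mono) auto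
  finally have "2 * (n + 1)\<^sup>2 \<le> n ^ 5" by (simp flip: power_add)
  then have "(2 * (n + 1)\<^sup>2) ^ d \<le> n ^ (5 * d)" unfolding power_mult by (rule power_mono) simp
  moreover have "call_cost n d + 40 \<le> n * (2 * (n + 1)\<^sup>2) ^ d"
    using call_cost_le[of n d] mult_right_mono[OF assms, of "(2 * (n + 1)\<^sup>2) ^ d"] by linarith
  ultimately have "call_cost n d + 40 \<le> n * n ^ (5 * d)" by (meson mult_le_mono2 order_trans)
  then have "n * n * (call_cost n d + 40) \<le> n * n * (n * n ^ (5 * d))" by (rule mult_left_mono) simp
  moreover have "7 + 10 * n \<le> 20 * (n * n)"
    using mult_right_mono[OF assms, of n] assms by linarith
  then have "run_cost n d \<le> n * n * (call_cost n d + 40)"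
    by (simp add: run_cost_def algebra_simps)
  ultimately have "run_cost n d \<le> n * n * (n * n ^ (5 * d))" by (metis order_trans)
  also have "\<dots> = n ^ (5 * d + 3)" by (simp add: power_add eval_nat_numeral)
  finally show ?thesis .
qed


section \<open>Verification of the program\<close>

text \<open>Words have to hold matrix positions up to \<open>n * n\<close>, loads up to
  \<open>2 * n\<close> and all addresses. The \<open>m\<close> cells are the 14 below the stack and
  \<open>L + 1\<close> frames of four words. By \<open>n_le\<close> every vertex is hit by round
  \<open>L\<close>.\<close>

locale ram = graph +
  fixes wl m L :: nat
  assumes word: "n * n + 2 * n + 2 \<le> 2 ^ wl" and m_word: "m < 2 ^ wl"
    and m_def: "m = 18 + 4 * L" and n_le: "n \<le> 2 ^ L"
begin

text \<open>A Hoare-style judgement for total correctness. Its time is only an upper bound, so costs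
  can be rounded up and added. Earlier halting is excluded because \<open>computes\<close> asks for
  the first halting time, and the cell bound yields the space bound.\<close>

definition reach :: "nat \<Rightarrow> config \<Rightarrow> (config \<Rightarrow> bool) \<Rightarrow> bool" where
  "reach T s Q \<longleftrightarrow> (\<exists>t\<le>T. Q ((step prog wl (graph_input n E) ^^ t) s) \<and>
     (\<forall>i<t. let c = (step prog wl (graph_input n E) ^^ i) s in
        \<not> halted prog c \<and> touched (prog ! pc c) c \<subseteq> {..<m}))"

lemma reach_refl: "Q s \<Longrightarrow> reach T s Q"
  unfolding reach_def by (rule exI[of _ 0]) simp

lemma reach_mono: "reach T s Q \<Longrightarrow> T \<le> T' \<Longrightarrow> (\<And>c. Q c \<Longrightarrow> Q' c) \<Longrightarrow> reach T' s Q'"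
  unfolding reach_def by (meson order_trans)

lemma reach_trans:
  assumes "reach T1 s Q" and "\<And>c. Q c \<Longrightarrow> reach T2 c Q'"
  shows "reach (T1 + T2) s Q'"
proof -
  let ?f = "step prog wl (graph_input n E)"
  from assms(1) obtain t1 where t1: "t1 \<le> T1" "Q ((?f ^^ t1) s)"
    "\<And>i. i < t1 \<Longrightarrow> let c = (?f ^^ i) s in \<not> halted prog c \<and> touched (prog ! pc c) c \<subseteq> {..<m}"
    unfolding reach_def by blast
  from assms(2)[OF t1(2)] obtain t2 where t2: "t2 \<le> T2" "Q' ((?f ^^ t2) ((?f ^^ t1) s))"
    "\<And>i. i < t2 \<Longrightarrow> let c = (?f ^^ i) ((?f ^^ t1) s) in
       \<not> halted prog c \<and> touched (prog ! pc c) c \<subseteq> {..<m}"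
    unfolding reach_def by blast
  have split: "(?f ^^ (i + t1)) s = (?f ^^ i) ((?f ^^ t1) s)" for i
    by (simp add: funpow_add)
  show ?thesis unfolding reach_def
  proof (intro exI[of _ "t2 + t1"] conjI allI impI)
    fix i assume "i < t2 + t1"
    show "let c = (?f ^^ i) s in \<not> halted prog c \<and> touched (prog ! pc c) c \<subseteq> {..<m}"
    proof (cases "i < t1")
      case False
      then have "i = (i - t1) + t1" "i - t1 < t2" using \<open>i < t2 + t1\<close> by auto
      then show ?thesis using t2(3) split by metis
    qed (rule t1(3))
  qed (use t1 t2 split in auto)
qed

lemma reach_seq: "reach T1 s (\<lambda>c. c = s') \<Longrightarrow> reach T2 s' Q \<Longrightarrow> reach (T1 + T2) s Q"
  using reach_trans by blast

lemma reach_step: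
  assumes "pc s < 74" "touched (prog ! pc s) s \<subseteq> {..<m}"
    and "reach T (exec wl (graph_input n E) (prog ! pc s) s) Q"
  shows "reach (Suc T) s Q"
proof -
  let ?f = "step prog wl (graph_input n E)"
  have nh: "\<not> halted prog s" using assms(1) by (simp add: halted_def length_prog)
  then have f: "?f s = exec wl (graph_input n E) (prog ! pc s) s" by (simp add: step_def)
  have "reach 1 s (\<lambda>c. c = ?f s)"
    unfolding reach_def using nh assms(2) by (intro exI[of _ 1]) (simp add: Let_def)
  from reach_trans[OF this] f assms(3) show ?thesis by fastforce
qed

section \<open>Symbolic execution of configurations\<close>

text \<open>
  The cells 2 to 13 serve as registers, holding the constant 1, \<open>n\<close>, the vertex \<open>a\<close> to be
  tested for output, the arguments \<open>u\<close> and \<open>R\<close> of the current call, its loop variables \<open>r\<close>, \<open>v\<close>,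
  \<open>w\<close>, the partial load \<open>s\<close>, a temporary \<open>t\<close>, the result \<open>y\<close> of the last call and the stack
  pointer. The stack starts at cell 14.
\<close>

definition memory :: "nat \<Rightarrow> nat \<Rightarrow> nat \<Rightarrow> nat \<Rightarrow> nat \<Rightarrow> nat \<Rightarrow> nat \<Rightarrow> nat \<Rightarrow> nat \<Rightarrow> nat \<Rightarrow>
    (nat \<Rightarrow> nat) \<Rightarrow> nat \<Rightarrow> nat" where
  "memory a u R r v w s t y sp stk i =
    (if i = 2 then 1 else if i = 3 then n else if i = 4 then a else if i = 5 then u else
     if i = 6 then R else if i = 7 then r else if i = 8 then v else if i = 9 then w else
     if i = 10 then s else if i = 11 then t else if i = 12 then y else if i = 13 then sp else
     if i < 14 then 0 else stk i)"

text \<open>A normal form for all configurations after the first three instructions;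
  \<open>set_cell_Cf\<close> preserves it, so executing an instruction is rewriting.\<close>

definition Cf :: "nat \<Rightarrow> nat \<Rightarrow> nat \<Rightarrow> nat \<Rightarrow> nat \<Rightarrow> nat \<Rightarrow> nat \<Rightarrow> nat \<Rightarrow> nat \<Rightarrow> nat \<Rightarrow> nat \<Rightarrow>
    (nat \<Rightarrow> nat) \<Rightarrow> nat list \<Rightarrow> config" where
  "Cf p a u R r v w s t y sp stk ys =
    \<lparr>pc = p, mem = memory a u R r v w s t y sp stk, out = ys\<rparr>"

lemma pc_Cf: "pc (Cf p a u R r v w s t y sp stk ys) = p"
  by (simp add: Cf_def)

lemma mem_Cf:
  "mem (Cf p a u R r v w s t y sp stk ys) 2 = 1"
  "mem (Cf p a u R r v w s t y sp stk ys) 3 = n"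
  "mem (Cf p a u R r v w s t y sp stk ys) 4 = a"
  "mem (Cf p a u R r v w s t y sp stk ys) 5 = u"
  "mem (Cf p a u R r v w s t y sp stk ys) 6 = R"
  "mem (Cf p a u R r v w s t y sp stk ys) 7 = r"
  "mem (Cf p a u R r v w s t y sp stk ys) 8 = v"
  "mem (Cf p a u R r v w s t y sp stk ys) 9 = w"
  "mem (Cf p a u R r v w s t y sp stk ys) 10 = s"
  "mem (Cf p a u R r v w s t y sp stk ys) 11 = t"
  "mem (Cf p a u R r v w s t y sp stk ys) 12 = y"
  "mem (Cf p a u R r v w s t y sp stk ys) 13 = sp"
  "14 \<le> i \<Longrightarrow> mem (Cf p a u R r v w s t y sp stk ys) i = stk i"
  by (simp_all add: Cf_def memory_def)

lemma set_cell_Cf: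
  "set_cell wl 4 x (Cf p a u R r v w s t y sp stk ys) = Cf (Suc p) (x mod 2 ^ wl) u R r v w s t y sp stk ys"
  "set_cell wl 5 x (Cf p a u R r v w s t y sp stk ys) = Cf (Suc p) a (x mod 2 ^ wl) R r v w s t y sp stk ys"
  "set_cell wl 6 x (Cf p a u R r v w s t y sp stk ys) = Cf (Suc p) a u (x mod 2 ^ wl) r v w s t y sp stk ys"
  "set_cell wl 7 x (Cf p a u R r v w s t y sp stk ys) = Cf (Suc p) a u R (x mod 2 ^ wl) v w s t y sp stk ys"
  "set_cell wl 8 x (Cf p a u R r v w s t y sp stk ys) = Cf (Suc p) a u R r (x mod 2 ^ wl) w s t y sp stk ys"
  "set_cell wl 9 x (Cf p a u R r v w s t y sp stk ys) = Cf (Suc p) a u R r v (x mod 2 ^ wl) s t y sp stk ys"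
  "set_cell wl 10 x (Cf p a u R r v w s t y sp stk ys) = Cf (Suc p) a u R r v w (x mod 2 ^ wl) t y sp stk ys"
  "set_cell wl 11 x (Cf p a u R r v w s t y sp stk ys) = Cf (Suc p) a u R r v w s (x mod 2 ^ wl) y sp stk ys"
  "set_cell wl 12 x (Cf p a u R r v w s t y sp stk ys) = Cf (Suc p) a u R r v w s t (x mod 2 ^ wl) sp stk ys"
  "set_cell wl 13 x (Cf p a u R r v w s t y sp stk ys) = Cf (Suc p) a u R r v w s t y (x mod 2 ^ wl) stk ys"
  "14 \<le> i \<Longrightarrow> set_cell wl i x (Cf p a u R r v w s t y sp stk ys) = Cf (Suc p) a u R r v w s t y sp (stk(i := x mod 2 ^ wl)) ys"
  by (auto simp: set_cell_def Cf_def memory_def fun_eq_iff)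

lemma pc_upd_Cf: "Cf p a u R r v w s t y sp stk ys\<lparr>pc := q\<rparr> = Cf q a u R r v w s t y sp stk ys"
  by (simp add: Cf_def)

lemma out_Cf:
  "out (Cf p a u R r v w s t y sp stk ys) = ys"
  "Cf p a u R r v w s t y sp stk ys\<lparr>out := zs\<rparr> = Cf p a u R r v w s t y sp stk zs"
  by (simp_all add: Cf_def)

lemma prog_nth:
  "prog ! 3 = JumpLess 4 3 5" "prog ! 4 = Jump 74" "prog ! 5 = Const 5 0"
  "prog ! 6 = JumpLess 5 3 8" "prog ! 7 = Jump 72" "prog ! 8 = Op Or 6 3 3"
  "prog ! 9 = Const 7 0"
  "prog ! 10 = JumpLess 7 6 12" "prog ! 11 = Jump 61" "prog ! 12 = Const 8 0"
  "prog ! 13 = JumpLess 8 3 15" "prog ! 14 = Jump 65"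
  "prog ! 15 = Op Xor 11 5 8" "prog ! 16 = JumpZero 11 22"
  "prog ! 17 = Op Mul 11 5 3" "prog ! 18 = Op Add 11 11 8" "prog ! 19 = Op Add 11 11 2"
  "prog ! 20 = Read 11 11" "prog ! 21 = JumpZero 11 63"
  "prog ! 22 = Const 10 0" "prog ! 23 = Const 9 0"
  "prog ! 24 = JumpLess 9 3 26" "prog ! 25 = Jump 60"
  "prog ! 26 = Op Xor 11 8 9" "prog ! 27 = JumpZero 11 33"
  "prog ! 28 = Op Mul 11 8 3" "prog ! 29 = Op Add 11 11 9" "prog ! 30 = Op Add 11 11 2"
  "prog ! 31 = Read 11 11" "prog ! 32 = JumpZero 11 58"
  "prog ! 33 = Store 13 6" "prog ! 34 = Op Add 13 13 2" "prog ! 35 = Store 13 5"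
  "prog ! 36 = Op Add 13 13 2" "prog ! 37 = Store 13 8" "prog ! 38 = Op Add 13 13 2"
  "prog ! 39 = Store 13 10" "prog ! 40 = Op Add 13 13 2"
  "prog ! 41 = Op Or 6 7 7" "prog ! 42 = Op Or 5 9 9" "prog ! 43 = Jump 9"
  "prog ! 44 = Const 11 14" "prog ! 45 = JumpLess 11 13 47" "prog ! 46 = Jump 67"
  "prog ! 47 = Op Or 7 6 6" "prog ! 48 = Op Or 9 5 5"
  "prog ! 49 = Op Sub 13 13 2" "prog ! 50 = Load 10 13" "prog ! 51 = Op Sub 13 13 2"
  "prog ! 52 = Load 8 13" "prog ! 53 = Op Sub 13 13 2" "prog ! 54 = Load 5 13"
  "prog ! 55 = Op Sub 13 13 2" "prog ! 56 = Load 6 13" "prog ! 57 = Op Add 10 10 12"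
  "prog ! 58 = Op Add 9 9 2" "prog ! 59 = Jump 24"
  "prog ! 60 = JumpLess 10 3 63" "prog ! 61 = Op Shl 12 2 7" "prog ! 62 = Jump 44"
  "prog ! 63 = Op Add 8 8 2" "prog ! 64 = Jump 13"
  "prog ! 65 = Op Add 7 7 2" "prog ! 66 = Jump 10"
  "prog ! 67 = Op Xor 11 8 4" "prog ! 68 = JumpZero 11 71" "prog ! 69 = Op Add 5 5 2"
  "prog ! 70 = Jump 6" "prog ! 71 = Write 4" "prog ! 72 = Op Add 4 4 2" "prog ! 73 = Jump 3"
  by (simp_all add: prog_def)

lemma m_ge: "14 < m" "13 < m" "12 < m" "11 < m" "10 < m" "9 < m" "8 < m" "7 < m" "6 < m"
  "5 < m" "4 < m" "3 < m" "2 < m"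
  by (simp_all add: m_def)

text \<open>The first bound serves addresses and round numbers, the second vertices and dual
  values.\<close>

lemma mod_word: "x \<le> m \<Longrightarrow> x mod 2 ^ wl = x" "x < 2 * n + 2 \<Longrightarrow> x mod 2 ^ wl = x"
  using m_word word by simp_all

text \<open>The machine adds \<open>2 ^ wl - 1\<close>, and the reduction on storing cancels
  \<open>2 ^ wl\<close>.\<close>

lemma sub_word:
  assumes "0 < x" "x \<le> m"
  shows "binop_val wl Sub x (Suc 0) mod 2 ^ wl = x - 1"
proof -
  have "(2::nat) ^ wl > 0" by simp
  then have *: "x + (2 ^ wl - Suc 0) = (x - 1) + 2 ^ wl" using assms(1) by linarith
  have "x - 1 < 2 ^ wl" using assms m_word by linarith
  then show ?thesis by (simp only: binop_val.simps * mod_add_self2 mod_less)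
qed

lemma wl_pos: "0 < wl"
  using word by (cases "wl = 0") simp_all

lemma stack_word: "14 mod 2 ^ wl = (14 :: nat)"
  using mod_word(1)[of 14] m_ge by simp

lemmas sym_simps = stack_word prog_nth pc_Cf mem_Cf set_cell_Cf pc_upd_Cf out_Cf m_ge wl_pos

text \<open>Row-major indexing. The length bound is carried along because the induction needs it to
  see that appending a row leaves old entries in place.\<close>

lemma nth_concat_map:
  assumes "\<And>x. length (f x) = n" "u < k" "v < n"
  shows "concat (map f [0..<k]) ! (u * n + v) = f u ! v \<and> u * n + v < length (concat (map f [0..<k]))"
  using assms(2)
proof (induction k)
  case (Suc k)
  have len: "length (concat (map f [0..<k])) = k * n" for k
    using assms(1) by (induction k) auto
  show ?case
  proof (cases "u = k")
    case True
    then show ?thesis using assms(1,3) len[of k] by (simp add: nth_append)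
  next
    case False
    then have "u < k" using Suc.prems by simp
    with Suc.IH have "concat (map f [0..<k]) ! (u * n + v) = f u ! v"
       "u * n + v < length (concat (map f [0..<k]))" by auto
    then show ?thesis by (simp add: nth_append)
  qed
qed simp

text \<open>The successor skips the leading word \<open>n\<close> of the input.\<close>

lemma input_edge:
  assumes "u < n" "v < n"
  shows "input_word (graph_input n E) (Suc (u * n + v)) = of_bool ({u, v} \<in> E)"
proof -
  have "concat (map (\<lambda>u. map (\<lambda>v. of_bool ({u, v} \<in> E)) [0..<n]) [0..<n]) ! (u * n + v)
     = (map (\<lambda>v. of_bool ({u, v} \<in> E)) [0..<n] ! v :: nat) \<and>
     u * n + v < length (concat (map (\<lambda>u. map (\<lambda>v. of_bool ({u, v} \<in> E) :: nat) [0..<n]) [0..<n]))"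
    by (rule nth_concat_map) (use assms in auto)
  then show ?thesis using assms by (simp add: input_word_def graph_input_def)
qed

lemma index_word:
  assumes "u < n" "v < n"
  shows "(u * n) mod 2 ^ wl = u * n" "(u * n + v) mod 2 ^ wl = u * n + v"
    "Suc (u * n + v) mod 2 ^ wl = Suc (u * n + v)"
proof -
  have "u * n \<le> n * n" using assms by simp
  then have "Suc (u * n + v) < 2 ^ wl" using assms word by linarith
  then show "(u * n) mod 2 ^ wl = u * n" "(u * n + v) mod 2 ^ wl = u * n + v"
    "Suc (u * n + v) mod 2 ^ wl = Suc (u * n + v)" by auto
qed

lemma xor_word:
  assumes "u < n" "v < n"
  shows "Bit_Operations.xor u v mod 2 ^ wl = 0 \<longleftrightarrow> u = v"
proof -
  have "u mod 2 ^ wl = u" "v mod 2 ^ wl = v" using assms by (simp_all add: mod_word)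
  then have "Bit_Operations.xor u v mod 2 ^ wl = Bit_Operations.xor u v"
    by (metis take_bit_eq_mod take_bit_xor)
  moreover have "Bit_Operations.xor u v = 0 \<longleftrightarrow> u = v"
    by (auto simp: bit_eq_iff bit_simps)
  ultimately show ?thesis by simp
qed

text \<open>Repeated application executes straight-line code. It stops when the bound has been
  simplified to one, which no longer matches \<open>numeral k\<close>; hence the literal bounds
  below are one more than the number of instructions executed.\<close>

lemma reach_num:
  assumes "pc s < 74" "touched (prog ! pc s) s \<subseteq> {..<m}"
    and "reach (pred_numeral k) (exec wl (graph_input n E) (prog ! pc s) s) Q"
  shows "reach (numeral k) s Q"
  using reach_step[OF assms] by (simp add: numeral_eq_Suc)

section \<open>Neighbourhood tests and stack frames\<close>

lemma test_uv:
  assumes "u < n" "v < n"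
  shows "reach 8 (Cf 15 a u R r v w s t y sp stk ys)
     (\<lambda>c. \<exists>t'. c = Cf (if v \<in> nb u then 22 else 63) a u R r v w s t' y sp stk ys)"
proof -
  have nb: "v \<in> nb u \<longleftrightarrow> u = v \<or> {u, v} \<in> E"
    using assms by (auto simp: nb_def)
  \<comment> \<open>Naming the target \<open>q\<close> keeps its conditional out of the symbolic
    execution.\<close>
  have "reach 8 (Cf 15 a u R r v w s t y sp stk ys)
     (\<lambda>c. \<exists>t'. c = Cf q a u R r v w s t' y sp stk ys)"
    if q: "q = (if v \<in> nb u then 22 else 63)" for q
  proof -
    \<comment> \<open>The three paths through the code. Equality bypasses the matrix, whose diagonal
      is zero.\<close>
    consider (1) "u = v" | (2) "u \<noteq> v" "{u, v} \<in> E" | (3) "u \<noteq> v" "{u, v} \<notin> E"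
      by blast
    then show ?thesis
    proof cases
      case 1
      have "reach 3 (Cf 15 a u R r v w s t y sp stk ys)
          (\<lambda>c. \<exists>t'. c = Cf q a u R r v w s t' y sp stk ys)"
        by ((rule reach_num; simp add: sym_simps assms mod_word xor_word index_word[OF assms]
              input_edge 1 split del: if_split)+, rule reach_refl, use 1 q nb in auto)
      then show ?thesis by (rule reach_mono) auto
    next
      case 2
      have "reach 8 (Cf 15 a u R r v w s t y sp stk ys)
          (\<lambda>c. \<exists>t'. c = Cf q a u R r v w s t' y sp stk ys)"
        by ((rule reach_num; simp add: sym_simps assms mod_word xor_word index_word[OF assms]
              input_edge 2 split del: if_split)+, rule reach_refl, use 2 q nb in auto)
      then show ?thesis by (rule reach_mono) auto
    next
      case 3
      have "reach 8 (Cf 15 a u R r v w s t y sp stk ys)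
          (\<lambda>c. \<exists>t'. c = Cf q a u R r v w s t' y sp stk ys)"
        by ((rule reach_num; simp add: sym_simps assms mod_word xor_word index_word[OF assms]
              input_edge 3 split del: if_split)+, rule reach_refl, use 3 q nb in auto)
      then show ?thesis by (rule reach_mono) auto
    qed
  qed
  then show ?thesis by presburger
qed

lemma test_vw:
  assumes "v < n" "w < n"
  shows "reach 8 (Cf 26 a u R r v w s t y sp stk ys)
     (\<lambda>c. \<exists>t'. c = Cf (if w \<in> nb v then 33 else 58) a u R r v w s t' y sp stk ys)"
proof -
  have nb: "w \<in> nb v \<longleftrightarrow> v = w \<or> {v, w} \<in> E"
    using assms by (auto simp: nb_def)
  have "reach 8 (Cf 26 a u R r v w s t y sp stk ys)
     (\<lambda>c. \<exists>t'. c = Cf q a u R r v w s t' y sp stk ys)"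
    if q: "q = (if w \<in> nb v then 33 else 58)" for q
  proof -
    consider (1) "v = w" | (2) "v \<noteq> w" "{v, w} \<in> E" | (3) "v \<noteq> w" "{v, w} \<notin> E"
      by blast
    then show ?thesis
    proof cases
      case 1
      have "reach 3 (Cf 26 a u R r v w s t y sp stk ys)
          (\<lambda>c. \<exists>t'. c = Cf q a u R r v w s t' y sp stk ys)"
        by ((rule reach_num; simp add: sym_simps assms mod_word xor_word index_word[OF assms]
              input_edge 1 split del: if_split)+, rule reach_refl, use 1 q nb in auto)
      then show ?thesis by (rule reach_mono) auto
    next
      case 2
      have "reach 8 (Cf 26 a u R r v w s t y sp stk ys)
          (\<lambda>c. \<exists>t'. c = Cf q a u R r v w s t' y sp stk ys)"
        by ((rule reach_num; simp add: sym_simps assms mod_word xor_word index_word[OF assms]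
              input_edge 2 split del: if_split)+, rule reach_refl, use 2 q nb in auto)
      then show ?thesis by (rule reach_mono) auto
    next
      case 3
      have "reach 8 (Cf 26 a u R r v w s t y sp stk ys)
          (\<lambda>c. \<exists>t'. c = Cf q a u R r v w s t' y sp stk ys)"
        by ((rule reach_num; simp add: sym_simps assms mod_word xor_word index_word[OF assms]
              input_edge 3 split del: if_split)+, rule reach_refl, use 3 q nb in auto)
      then show ?thesis by (rule reach_mono) auto
    qed
  qed
  then show ?thesis by presburger
qed

lemma push_frame:
  assumes "14 \<le> sp" "sp + 4 \<le> m" "R < 2 ^ wl" "r < 2 ^ wl"
    "u < n" "v < n" "w < n" "s < 2 * n + 2"
  shows "reach 12 (Cf 33 a u R r v w s t y sp stk ys)
     (\<lambda>c. c = Cf 9 a w r r v w s t y (sp + 4) (stk(sp := R, sp + 1 := u, sp + 2 := v, sp + 3 := s)) ys)"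
  by ((rule reach_num; use assms in \<open>simp add: sym_simps mod_word\<close>)+,
      rule reach_refl, simp add: numeral_eq_Suc)

text \<open>The argument cells of the callee still hold \<open>w\<close> and \<open>r\<close>, from
  which the loop variables of the caller are restored; the frame supplies the rest.\<close>

lemma pop_frame:
  assumes "14 \<le> sp" "sp + 4 \<le> m" "R < 2 ^ wl" "r < 2 ^ wl"
    "u < n" "v < n" "w < n" "s < 2 * n + 2" "s + y < 2 * n + 2"
    "stk sp = R" "stk (sp + 1) = u" "stk (sp + 2) = v" "stk (sp + 3) = s"
  shows "reach 14 (Cf 44 a w r r' v' w' s' t y (sp + 4) stk ys)
     (\<lambda>c. \<exists>t. c = Cf 58 a u R r v w (s + y) t y sp stk ys)"
  by ((rule reach_num; use assms in \<open>simp add: sym_simps mod_word sub_word del: binop_val.simps(2)\<close>)+,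
      rule reach_refl, use assms in \<open>auto simp: mod_word ac_simps\<close>)

section \<open>The recursive procedure\<close>

abbreviation cost :: "nat \<Rightarrow> nat" where
  "cost \<equiv> call_cost n"

text \<open>Cells from \<open>sp\<close> upwards are left open because deeper calls overwrite them.
  The last conjunct is what the main loop relies on.\<close>

definition returned :: "nat \<Rightarrow> nat \<Rightarrow> nat \<Rightarrow> nat \<Rightarrow> (nat \<Rightarrow> nat) \<Rightarrow> nat list \<Rightarrow> config \<Rightarrow> bool" where
  "returned a u R sp stk ys c \<longleftrightarrow> (\<exists>r v w s t stk'.
     c = Cf 44 a u R r v w s t (pk R u) sp stk' ys \<and> (\<forall>i<sp. stk' i = stk i) \<and>
     (fst_hit u < R \<longrightarrow> v = sel u))"

text \<open>The search ends by round \<open>L\<close> whatever \<open>R\<close> is. Time and stack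
  are therefore measured by \<open>min R (Suc L)\<close>, which keeps the call with
  \<open>R = n\<close> at logarithmic depth.\<close>

definition call_ok :: "nat \<Rightarrow> bool" where
  "call_ok R \<longleftrightarrow> (\<forall>a u r v w s t y sp stk ys.
     u < n \<longrightarrow> 14 \<le> sp \<longrightarrow> sp + 4 * min R (Suc L) \<le> m \<longrightarrow>
     reach (cost (min R (Suc L))) (Cf 9 a u R r v w s t y sp stk ys) (returned a u R sp stk ys))"

lemma L_word: "L + 4 \<le> m"
  by (simp add: m_def)

definition loaded :: "nat \<Rightarrow> nat \<Rightarrow> nat \<Rightarrow> nat \<Rightarrow> nat \<Rightarrow> nat \<Rightarrow> (nat \<Rightarrow> nat) \<Rightarrow> nat list \<Rightarrow> config \<Rightarrow> bool" where
  "loaded a u R r v sp stk ys c \<longleftrightarrow> (\<exists>t y stk'.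
     c = Cf 60 a u R r v n (load r v) t y sp stk' ys \<and> (\<forall>i<sp. stk' i = stk i))"

text \<open>The stack holds one new frame and at most \<open>r\<close> frames of the callee. The
  overhead 40 of an iteration is 2 for the loop test, 8 for the adjacency test, 27 covering push and
  pop, and 3 for the increment.\<close>

lemma loop_w:
  assumes call: "call_ok r" and r: "r \<le> L" and R: "R < 2 ^ wl" and uv: "u < n" "v < n"
    and sp: "14 \<le> sp" "sp + 4 + 4 * r \<le> m"
  shows "w \<le> n \<Longrightarrow> reach ((n - w) * (40 + cost r) + 3)
    (Cf 24 a u R r v w (\<Sum>x\<in>nb v \<inter> {..<w}. pk r x) t y sp stk ys) (loaded a u R r v sp stk ys)"
proof (induction "n - w" arbitrary: w t y stk)
  case 0
  have n: "nb v \<inter> {..<n} = nb v" by (auto simp: nb_def)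
  have "w = n" using 0 by simp
  have "reach 3 (Cf 24 a u R r v n (load r v) t y sp stk ys) (loaded a u R r v sp stk ys)"
    by ((rule reach_num; simp add: sym_simps)+, rule reach_refl, auto simp: loaded_def)
  then show ?case using \<open>w = n\<close> n by (simp add: load_def)
next
  case (Suc k)
  let ?s = "\<Sum>x\<in>nb v \<inter> {..<w}. pk r x"
  let ?s' = "\<Sum>x\<in>nb v \<inter> {..<Suc w}. pk r x"
  have w: "w < n" using Suc.hyps by simp
  have r_word: "r < 2 ^ wl" using r L_word m_word by simp
  \<comment> \<open>Partial sums are bounded by the full load, so the additions do not wrap
    around.\<close>
  have s'_le: "?s' \<le> 2 * n"
    using sum_mono2[of "nb v" "nb v \<inter> {..<Suc w}" "pk r"] load_le[of r v] by (simp add: load_def)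
  have nxt: "reach ((n - Suc w) * (40 + cost r) + 6)
      (Cf 58 a u R r v w ?s' t y sp stk' ys) (loaded a u R r v sp stk ys)"
    if "\<forall>i<sp. stk' i = stk i" for t y stk'
  proof -
    have "reach 3 (Cf 58 a u R r v w ?s' t y sp stk' ys) (\<lambda>c. c = Cf 24 a u R r v (Suc w) ?s' t y sp stk' ys)"
      by ((rule reach_num; use w in \<open>simp add: sym_simps mod_word\<close>)+, rule reach_refl, simp)
    moreover have "reach ((n - Suc w) * (40 + cost r) + 3)
      (Cf 24 a u R r v (Suc w) ?s' t y sp stk' ys) (loaded a u R r v sp stk' ys)"
      using Suc.hyps w by (intro Suc.hyps(1)) auto
    then have "reach ((n - Suc w) * (40 + cost r) + 3)
      (Cf 24 a u R r v (Suc w) ?s' t y sp stk' ys) (loaded a u R r v sp stk ys)"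
      by (rule reach_mono) (use that in \<open>auto simp: loaded_def\<close>)
    ultimately have "reach (3 + ((n - Suc w) * (40 + cost r) + 3))
      (Cf 58 a u R r v w ?s' t y sp stk' ys) (loaded a u R r v sp stk ys)"
      by (rule reach_seq)
    then show ?thesis by (rule reach_mono) auto
  qed
  have body: "reach (27 + cost r) (Cf (if w \<in> nb v then 33 else 58) a u R r v w ?s t y sp stk ys)
     (\<lambda>c. \<exists>t y stk'. c = Cf 58 a u R r v w ?s' t y sp stk' ys \<and> (\<forall>i<sp. stk' i = stk i))" for t
  proof (cases "w \<in> nb v")
    case False
    then have "nb v \<inter> {..<Suc w} = nb v \<inter> {..<w}" by (auto simp: less_Suc_eq)
    with False show ?thesis by (intro reach_refl) auto
  next
    case True
    then have "nb v \<inter> {..<Suc w} = insert w (nb v \<inter> {..<w})" by (auto simp: less_Suc_eq)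
    then have s': "?s' = ?s + pk r w" by simp
    let ?stk = "stk(sp := R, sp + 1 := u, sp + 2 := v, sp + 3 := ?s)"
    have 1: "reach 12 (Cf 33 a u R r v w ?s t y sp stk ys)
       (\<lambda>c. c = Cf 9 a w r r v w ?s t y (sp + 4) ?stk ys)"
      using sp R r_word uv w s'_le s' by (intro push_frame) auto
    have 2: "reach (cost r) (Cf 9 a w r r v w ?s t y (sp + 4) ?stk ys) (returned a w r (sp + 4) ?stk ys)"
      using call w sp r unfolding call_ok_def by (metis add.commute le_SucI min.absorb1 trans_le_add2)
    have 3: "reach 14 c (\<lambda>c. \<exists>t y stk'. c = Cf 58 a u R r v w ?s' t y sp stk' ys \<and> (\<forall>i<sp. stk' i = stk i))"
      if "returned a w r (sp + 4) ?stk ys c" for c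
    proof -
      obtain r' v' w' s'' t stk' where c: "c = Cf 44 a w r r' v' w' s'' t (pk r w) (sp + 4) stk' ys"
        "\<forall>i<sp + 4. stk' i = ?stk i" using \<open>returned _ _ _ _ _ _ _\<close> unfolding returned_def by blast
      have "reach 14 c (\<lambda>c. \<exists>t. c = Cf 58 a u R r v w (?s + pk r w) t (pk r w) sp stk' ys)"
        unfolding c(1) using sp R r_word uv w s'_le s' c(2) by (intro pop_frame) auto
      then show ?thesis
      proof (rule reach_mono)
        have "\<forall>i<sp. stk' i = stk i" using c(2) by auto
        then show "\<exists>t y stk'. c = Cf 58 a u R r v w ?s' t y sp stk' ys \<and> (\<forall>i<sp. stk' i = stk i)"
          if "\<exists>t. c = Cf 58 a u R r v w (?s + pk r w) t (pk r w) sp stk' ys" for c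
          using that s' by metis
      qed simp
    qed
    have "reach (12 + (cost r + 14)) (Cf 33 a u R r v w ?s t y sp stk ys)
      (\<lambda>c. \<exists>t y stk'. c = Cf 58 a u R r v w ?s' t y sp stk' ys \<and> (\<forall>i<sp. stk' i = stk i))"
      by (rule reach_seq[OF 1 reach_trans[OF 2 3]])
    then show ?thesis using True by (auto elim!: reach_mono)
  qed
  have 1: "reach 2 (Cf 24 a u R r v w ?s t y sp stk ys) (\<lambda>c. c = Cf 26 a u R r v w ?s t y sp stk ys)"
    by ((rule reach_num; use w in \<open>simp add: sym_simps\<close>)+, rule reach_refl, simp)
  have 2: "reach (8 + (27 + cost r + ((n - Suc w) * (40 + cost r) + 6)))
     (Cf 26 a u R r v w ?s t y sp stk ys) (loaded a u R r v sp stk ys)"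
    by (rule reach_trans[OF test_vw[OF uv(2) w]], clarify, rule reach_trans[OF body], clarify, erule nxt)
  from reach_seq[OF 1 2] show ?case
    by (rule reach_mono) (use w in \<open>simp_all add: Suc_diff_Suc[symmetric] del: Suc_diff_Suc\<close>)
qed

text \<open>Address 61 is the exit with a heavy neighbour, 65 the one to the next round. Minimality
  of \<open>v\<close> is recorded since \<open>sel\<close> takes the least candidate.\<close>

definition searched :: "nat \<Rightarrow> nat \<Rightarrow> nat \<Rightarrow> nat \<Rightarrow> nat \<Rightarrow> (nat \<Rightarrow> nat) \<Rightarrow> nat list \<Rightarrow> config \<Rightarrow> bool" where
  "searched a u R r sp stk ys c \<longleftrightarrow> (\<exists>v w s t y stk'.
     (c = Cf 61 a u R r v w s t y sp stk' ys \<and> v \<in> nb u \<and> n \<le> load r v \<and>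
        (\<forall>x<v. x \<in> nb u \<longrightarrow> load r x < n) \<or>
      c = Cf 65 a u R r v w s t y sp stk' ys \<and> \<not> hit r u) \<and> (\<forall>i<sp. stk' i = stk i))"

lemma loop_v:
  assumes call: "call_ok r" and r: "r \<le> L" and R: "R < 2 ^ wl" and u: "u < n"
    and sp: "14 \<le> sp" "sp + 4 + 4 * r \<le> m"
  shows "v \<le> n \<Longrightarrow> \<forall>x<v. x \<in> nb u \<longrightarrow> load r x < n \<Longrightarrow>
    reach ((n - v) * (22 + n * (40 + cost r)) + 3)
    (Cf 13 a u R r v w s t y sp stk ys) (searched a u R r sp stk ys)"
proof (induction "n - v" arbitrary: v w s t y stk)
  case 0
  then have "v = n" by simp
  have "\<not> hit r u" using 0 \<open>v = n\<close> by (auto simp: hit_def not_le dest: nb_less)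
  then have "reach 3 (Cf 13 a u R r n w s t y sp stk ys) (searched a u R r sp stk ys)"
    by - ((rule reach_num; simp add: sym_simps)+, rule reach_refl, unfold searched_def, blast)
  then show ?case using \<open>v = n\<close> by simp
next
  case (Suc k)
  have v: "v < n" using Suc.hyps by simp
  let ?T = "(n - Suc v) * (22 + n * (40 + cost r)) + 3"
  have nxt: "reach (3 + ?T) (Cf 63 a u R r v w s t y sp stk' ys) (searched a u R r sp stk ys)"
    if "\<forall>i<sp. stk' i = stk i" "v \<in> nb u \<longrightarrow> load r v < n" for w s t y stk'
  proof (rule reach_seq)
    show "reach 3 (Cf 63 a u R r v w s t y sp stk' ys) (\<lambda>c. c = Cf 13 a u R r (Suc v) w s t y sp stk' ys)"
      by ((rule reach_num; use v in \<open>simp add: sym_simps mod_word\<close>)+, rule reach_refl, simp)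
    have "reach ?T (Cf 13 a u R r (Suc v) w s t y sp stk' ys) (searched a u R r sp stk' ys)"
      using Suc.hyps(2) Suc.prems v that(2) by (intro Suc.hyps(1)) (auto simp: less_Suc_eq)
    then show "reach ?T (Cf 13 a u R r (Suc v) w s t y sp stk' ys) (searched a u R r sp stk ys)"
      by (rule reach_mono) (use that(1) in \<open>auto simp: searched_def\<close>)
  qed
  have check: "reach (5 + ?T) c (searched a u R r sp stk ys)"
    if ld: "loaded a u R r v sp stk ys c" and vu: "v \<in> nb u" for c
  proof -
    obtain t y stk' where c: "c = Cf 60 a u R r v n (load r v) t y sp stk' ys" "\<forall>i<sp. stk' i = stk i"
      using ld unfolding loaded_def by blast
    show ?thesis
    proof (cases "load r v < n")
      case True
      have "reach 2 c (\<lambda>c. c = Cf 63 a u R r v n (load r v) t y sp stk' ys)"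
        unfolding c(1) by ((rule reach_num; simp add: sym_simps True)+, rule reach_refl, simp)
      from reach_seq[OF this nxt] c(2) True show ?thesis by (simp add: eval_nat_numeral)
    next
      case False
      have "searched a u R r sp stk ys (Cf 61 a u R r v n (load r v) t y sp stk' ys)"
        unfolding searched_def using vu False Suc.prems c(2) not_less by blast
      then have "reach 2 c (searched a u R r sp stk ys)"
        unfolding c(1) by - ((rule reach_num; simp add: sym_simps False)+, intro reach_refl)
      then show ?thesis by (rule reach_mono) auto
    qed
  qed
  have body: "reach (11 + n * (40 + cost r) + ?T) (Cf (if v \<in> nb u then 22 else 63) a u R r v w s t y sp stk ys)
     (searched a u R r sp stk ys)" for t
  proof (cases "v \<in> nb u")
    case False
    then show ?thesis using nxt[of stk w s t y] by (auto elim!: reach_mono)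
  next
    case True
    have 1: "reach 3 (Cf 22 a u R r v w s t y sp stk ys) (\<lambda>c. c = Cf 24 a u R r v 0 0 t y sp stk ys)"
      by ((rule reach_num; simp add: sym_simps)+, rule reach_refl, simp)
    have 2: "reach (n * (40 + cost r) + 3) (Cf 24 a u R r v 0 0 t y sp stk ys) (loaded a u R r v sp stk ys)"
      using loop_w[OF call r R u v sp, where w = 0] by simp
    from reach_seq[OF 1 reach_trans[OF 2 check]] True show ?thesis by (simp add: add_ac)
  qed
  have 1: "reach 2 (Cf 13 a u R r v w s t y sp stk ys) (\<lambda>c. c = Cf 15 a u R r v w s t y sp stk ys)"
    by ((rule reach_num; use v in \<open>simp add: sym_simps\<close>)+, rule reach_refl, simp)
  have 2: "reach (8 + (11 + n * (40 + cost r) + ?T)) (Cf 15 a u R r v w s t y sp stk ys) (searched a u R r sp stk ys)"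
    by (rule reach_trans[OF test_uv[OF u v]], clarify, rule body)
  from reach_seq[OF 1 2] show ?case
    by (rule reach_mono) (use v in \<open>simp_all add: Suc_diff_Suc[symmetric] del: Suc_diff_Suc\<close>)
qed

lemma loop_r:
  assumes call: "\<And>r. r < R \<Longrightarrow> call_ok r" and R: "R < 2 ^ wl" and u: "u < n"
    and sp: "14 \<le> sp" "sp + 4 * min R (Suc L) \<le> m"
  shows "r \<le> min R (Suc L) \<Longrightarrow> \<forall>x<r. \<not> hit x u \<Longrightarrow>
    reach (8 + (\<Sum>i=r..<min R (Suc L). 10 + n * (22 + n * (40 + cost i))))
    (Cf 10 a u R r v w s t y sp stk ys) (returned a u R sp stk ys)"
proof (induction "min R (Suc L) - r" arbitrary: r v w s t y stk)
  case 0
  then have r: "r = min R (Suc L)" by simp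
  \<comment> \<open>If the search had stopped at \<open>Suc L\<close>, round \<open>L\<close> would
    have missed \<open>u\<close>. So it stopped at \<open>R\<close> and \<open>u\<close> was doubled
    in all \<open>R\<close> rounds.\<close>
  have "hit L u" using u n_le by (rule hit_large)
  with 0 r have "r = R" by (auto simp: min_def split: if_splits)
  have pk: "pk R u = 2 ^ R" using 0 \<open>r = R\<close> by (intro pk_unhit) auto
  have "\<not> fst_hit u < R" using hit_fst_hit[OF u] 0 \<open>r = R\<close> by auto
  then have "returned a u R sp stk ys (Cf 44 a u R R v w s t (2 ^ R) sp stk ys)"
    unfolding returned_def pk by blast
  \<comment> \<open>The shift that produces the result does not overflow.\<close>
  moreover have "2 ^ R < 2 * n + 2" using pk_le[OF u, of R] pk by simp
  ultimately have "reach 5 (Cf 10 a u R R v w s t y sp stk ys) (returned a u R sp stk ys)"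
    by - ((rule reach_num; simp add: sym_simps mod_word)+, intro reach_refl, simp)
  then show ?case using \<open>r = R\<close> by (auto elim!: reach_mono)
next
  case (Suc k)
  let ?d = "min R (Suc L)"
  have r: "r < R" "r \<le> L" "r < ?d" using Suc.hyps by auto
  have r_word: "Suc r \<le> m" using r L_word by simp
  let ?T = "\<Sum>i=Suc r..<?d. 10 + n * (22 + n * (40 + cost i))"
  have 1: "reach 3 (Cf 10 a u R r v w s t y sp stk ys) (\<lambda>c. c = Cf 13 a u R r 0 w s t y sp stk ys)"
    using r by - ((rule reach_num; simp add: sym_simps)+, rule reach_refl, simp)
  have 2: "reach (n * (22 + n * (40 + cost r)) + 3) (Cf 13 a u R r 0 w s t y sp stk ys)
     (searched a u R r sp stk ys)"
    using loop_v[OF call[OF r(1)] r(2) R u sp(1), where v = 0] sp(2) r(3) by simp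
  have 3: "reach (3 + (8 + ?T)) c (returned a u R sp stk ys)"
    if sr: "searched a u R r sp stk ys c" for c
  proof -
    obtain v w s t y stk' where agree: "\<forall>i<sp. stk' i = stk i" and
      c: "c = Cf 61 a u R r v w s t y sp stk' ys \<and> v \<in> nb u \<and> n \<le> load r v \<and>
        (\<forall>x<v. x \<in> nb u \<longrightarrow> load r x < n) \<or>
      c = Cf 65 a u R r v w s t y sp stk' ys \<and> \<not> hit r u"
      using sr unfolding searched_def by blast
    from c show ?thesis
    proof (elim disjE conjE)
      assume c: "c = Cf 61 a u R r v w s t y sp stk' ys" and v: "v \<in> nb u" "n \<le> load r v"
        and least: "\<forall>x<v. x \<in> nb u \<longrightarrow> load r x < n"
      have "hit r u" using v by (auto simp: hit_def)
      \<comment> \<open>All earlier rounds missed \<open>u\<close>, so this is the round in which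
        its value freezes.\<close>
      then have fh: "fst_hit u = r"
        using Suc.prems(2) hit_fst_hit[OF u] fst_hit_le by (metis le_neq_implies_less)
      have pk: "pk R u = 2 ^ r"
        using pk_final[OF u] fh r(1) by simp
      have "sel u = v" unfolding sel_def fh
        by (rule Least_equality) (use v least in \<open>auto simp: not_less[symmetric]\<close>)
      then have "returned a u R sp stk ys (Cf 44 a u R r v w s t (2 ^ r) sp stk' ys)"
        unfolding returned_def pk using agree by blast
      moreover have "2 ^ r < 2 * n + 2" using pk_le[OF u, of R] pk by simp
      ultimately have "reach 3 c (returned a u R sp stk ys)"
        unfolding c by - ((rule reach_num; simp add: sym_simps mod_word)+, intro reach_refl, simp)
      then show ?thesis by (rule reach_mono) auto
    next
      assume c: "c = Cf 65 a u R r v w s t y sp stk' ys" and nh: "\<not> hit r u"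
      have 1: "reach 3 c (\<lambda>c. c = Cf 10 a u R (Suc r) v w s t y sp stk' ys)"
        unfolding c using r_word
        by - ((rule reach_num; simp add: sym_simps mod_word)+, rule reach_refl, simp)
      have "reach (8 + ?T) (Cf 10 a u R (Suc r) v w s t y sp stk' ys) (returned a u R sp stk' ys)"
        using Suc.hyps(2) Suc.prems r nh by (intro Suc.hyps(1)) (auto simp: less_Suc_eq)
      then have "reach (8 + ?T) (Cf 10 a u R (Suc r) v w s t y sp stk' ys) (returned a u R sp stk ys)"
        by (rule reach_mono) (use agree in \<open>auto simp: returned_def\<close>)
      from reach_seq[OF 1 this] show ?thesis .
    qed
  qed
  from reach_seq[OF 1 reach_trans[OF 2 3]] show ?case
    by (rule reach_mono) (use r(3) in \<open>simp_all add: sum.atLeast_Suc_lessThan\<close>)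
qed

text \<open>Strong induction, since a call with bound \<open>R\<close> makes calls with arbitrary
  bounds below \<open>R\<close>.\<close>

lemma call_ok: "R < 2 ^ wl \<Longrightarrow> call_ok R"
proof (induction R rule: less_induct)
  case (less R)
  show ?case unfolding call_ok_def
  proof (intro allI impI)
    fix a u r v w s t y sp stk ys
    assume a: "u < n" "14 \<le> sp" "sp + 4 * min R (Suc L) \<le> m"
    have 1: "reach 2 (Cf 9 a u R r v w s t y sp stk ys) (\<lambda>c. c = Cf 10 a u R 0 v w s t y sp stk ys)"
      by ((rule reach_num; simp add: sym_simps)+, rule reach_refl, simp)
    have "call_ok r" if "r < R" for r using less that by simp
    note 2 = loop_r[OF this less.prems a, where r = 0]
    show "reach (cost (min R (Suc L))) (Cf 9 a u R r v w s t y sp stk ys) (returned a u R sp stk ys)"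
      by (rule reach_mono[OF reach_seq[OF 1 2]]) (simp_all add: call_cost_eq[of n "min R (Suc L)"] atLeast0LessThan)
  qed
qed

section \<open>The main loop\<close>

definition selected :: "nat set" where
  "selected = sel ` {..<n}"

definition tested :: "nat \<Rightarrow> nat list \<Rightarrow> config \<Rightarrow> bool" where
  "tested a ys c \<longleftrightarrow> (\<exists>u R r v w s t y stk.
     c = Cf 3 (Suc a) u R r v w s t y 14 stk (ys @ (if a \<in> selected then [a] else [])))"

text \<open>The search for a vertex selecting \<open>a\<close> stops at the first success, so
  \<open>a\<close> is written at most once.\<close>

lemma loop_u:
  assumes a: "a < n"
  shows "u \<le> n \<Longrightarrow> \<forall>x<u. sel x \<noteq> a \<Longrightarrow>
    reach ((n - u) * (20 + cost (Suc L)) + 5) (Cf 6 a u R r v w s t y 14 stk ys) (tested a ys)"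
proof (induction "n - u" arbitrary: u R r v w s t y stk)
  case 0
  then have "u = n" by simp
  then have "tested a ys (Cf 3 (Suc a) n R r v w s t y 14 stk ys)"
    using 0 by (force simp: tested_def selected_def)
  then have "reach 5 (Cf 6 a n R r v w s t y 14 stk ys) (tested a ys)"
    using a by - ((rule reach_num; simp add: sym_simps mod_word)+, intro reach_refl, simp)
  then show ?case using \<open>u = n\<close> by simp
next
  case (Suc k)
  have u: "u < n" using Suc.hyps by simp
  have n_word: "n < 2 ^ wl" using word by simp
  have 1: "reach 3 (Cf 6 a u R r v w s t y 14 stk ys) (\<lambda>c. c = Cf 9 a u n r v w s t y 14 stk ys)"
    using u n_word by - ((rule reach_num; simp add: sym_simps)+, rule reach_refl, simp)
  have "reach (cost (min n (Suc L))) (Cf 9 a u n r v w s t y 14 stk ys) (returned a u n 14 stk ys)"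
  proof -
    have "14 + 4 * min n (Suc L) \<le> m" by (simp add: m_def min_def)
    then show ?thesis using call_ok[OF n_word] u unfolding call_ok_def by simp
  qed
  moreover have "cost (min n (Suc L)) \<le> cost (Suc L)" by (rule call_cost_mono) simp
  ultimately have 2: "reach (cost (Suc L)) (Cf 9 a u n r v w s t y 14 stk ys) (returned a u n 14 stk ys)"
    by (rule reach_mono)
  let ?T = "(n - Suc u) * (20 + cost (Suc L)) + 5"
  have 3: "reach (12 + ?T) c (tested a ys)" if rt: "returned a u n 14 stk ys c" for c
  proof -
    \<comment> \<open>Every vertex is hit by round \<open>n - 1\<close>, strictly before the bound
      \<open>R = n\<close>, so \<open>returned\<close> guarantees that \<open>sel u\<close> is in
      the register of \<open>v\<close>.\<close>
    have "n \<le> 2 ^ (n - 1)" using u by (cases n) (auto simp: Suc_le_eq)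
    then have "fst_hit u < n" using fst_hit_le[OF hit_large[OF u]] u by fastforce
    then obtain r w s t y stk' where c: "c = Cf 44 a u n r (sel u) w s t y 14 stk' ys"
      using rt unfolding returned_def by blast
    have sel: "sel u < n" using sel_props(1)[OF u] nb_less by blast
    show ?thesis
    proof (cases "sel u = a")
      case True
      then have "tested a ys (Cf 3 (Suc a) u n r a w s 0 y 14 stk' (ys @ [a]))"
        using u by (force simp: tested_def selected_def)
      then have "reach 9 c (tested a ys)"
        unfolding c using a True
        by - ((rule reach_num; simp add: sym_simps mod_word)+, intro reach_refl, simp)
      then show ?thesis by (rule reach_mono) auto
    next
      case False
      have 1: "reach 8 c (\<lambda>c. \<exists>t. c = Cf 6 a (Suc u) n r (sel u) w s t y 14 stk' ys)"
        unfolding c using a u sel False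
        by - ((rule reach_num; simp add: sym_simps mod_word xor_word)+, rule reach_refl, auto)
      have 2: "reach ?T (Cf 6 a (Suc u) n r (sel u) w s t y 14 stk' ys) (tested a ys)" for t
        using Suc.hyps(2) Suc.prems u False by (intro Suc.hyps(1)) (auto simp: less_Suc_eq)
      have "reach (8 + ?T) c (tested a ys)" by (rule reach_trans[OF 1]) (use 2 in auto)
      then show ?thesis by (rule reach_mono) auto
    qed
  qed
  from reach_seq[OF 1 reach_trans[OF 2 3]] show ?case
    by (rule reach_mono) (use u in \<open>simp_all add: Suc_diff_Suc[symmetric] del: Suc_diff_Suc\<close>)
qed

lemma loop_a:
  "a \<le> n \<Longrightarrow> reach ((n - a) * (10 + n * (20 + cost (Suc L))) + 3) (Cf 3 a u R r v w s t y 14 stk ys)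
    (\<lambda>c. pc c = 74 \<and> out c = ys @ filter (\<lambda>x. x \<in> selected) [a..<n])"
proof (induction "n - a" arbitrary: a u R r v w s t y stk ys)
  case 0
  then have "a = n" by simp
  have "reach 3 (Cf 3 n u R r v w s t y 14 stk ys) (\<lambda>c. pc c = 74 \<and> out c = ys)"
    by ((rule reach_num; simp add: sym_simps)+, rule reach_refl, simp add: Cf_def)
  then show ?case using \<open>a = n\<close> by simp
next
  case (Suc k)
  have a: "a < n" using Suc.hyps by simp
  have 1: "reach 3 (Cf 3 a u R r v w s t y 14 stk ys) (\<lambda>c. c = Cf 6 a 0 R r v w s t y 14 stk ys)"
    using a by - ((rule reach_num; simp add: sym_simps)+, rule reach_refl, simp)
  have 2: "reach (n * (20 + cost (Suc L)) + 5) (Cf 6 a 0 R r v w s t y 14 stk ys) (tested a ys)"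
    using loop_u[OF a, where u = 0] by simp
  have 3: "reach ((n - Suc a) * (10 + n * (20 + cost (Suc L))) + 3) c
     (\<lambda>c. pc c = 74 \<and> out c = ys @ filter (\<lambda>x. x \<in> selected) [a..<n])" if ts: "tested a ys c" for c
  proof -
    obtain u R r v w s t y stk where
      c: "c = Cf 3 (Suc a) u R r v w s t y 14 stk (ys @ (if a \<in> selected then [a] else []))"
      using ts unfolding tested_def by blast
    show ?thesis unfolding c
      by (rule reach_mono[OF Suc.hyps(1)]) (use Suc.hyps(2) a in \<open>auto simp: upt_conv_Cons\<close>)
  qed
  from reach_seq[OF 1 reach_trans[OF 2 3]] show ?case
    by (rule reach_mono) (use a in \<open>simp_all add: Suc_diff_Suc[symmetric] del: Suc_diff_Suc\<close>)
qed

lemma reach_start: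
  "reach (run_cost n (Suc L)) \<lparr>pc = 0, mem = (\<lambda>_. 0), out = []\<rparr>
    (\<lambda>c. pc c = 74 \<and> out c = filter (\<lambda>x. x \<in> selected) [0..<n])"
proof -
  have nth: "prog ! 0 = Const 2 1" "prog ! Suc 0 = Read 3 11" "prog ! Suc (Suc 0) = Const 13 14"
    by (simp_all add: prog_def)
  have mw: "Suc 0 mod 2 ^ wl = Suc 0" "n mod 2 ^ wl = n" "14 mod 2 ^ wl = (14::nat)"
    using mod_word[of "Suc 0"] mod_word[of n] mod_word[of 14] m_ge by auto
  have "memory 0 0 0 0 0 0 0 0 0 14 (\<lambda>_. 0) = (\<lambda>_. 0)(2 := Suc 0, 3 := n, 13 := 14)"
    by (auto simp: memory_def fun_eq_iff)
  \<comment> \<open>Cell 11 is still zero, so \<open>Read 3 11\<close> fetches the first input word,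
    \<open>n\<close>.\<close>
  then have "reach (Suc (Suc (Suc 0))) \<lparr>pc = 0, mem = (\<lambda>_. 0), out = []\<rparr>
      (\<lambda>c. c = Cf 3 0 0 0 0 0 0 0 0 0 14 (\<lambda>_. 0) [])"
    by - ((rule reach_step; simp add: nth set_cell_def m_ge wl_pos mw input_word_def graph_input_def)+,
        rule reach_refl, simp add: Cf_def numeral_3_eq_3)
  from reach_seq[OF this loop_a] show ?thesis
    by (rule reach_mono) (simp_all add: run_cost_def)
qed

lemma computes_selected:
  "\<exists>t\<le>run_cost n (Suc L). \<exists>b\<le>wl * m.
    computes prog wl (graph_input n E) (filter (\<lambda>x. x \<in> selected) [0..<n]) t b"
proof -
  let ?run = "run prog wl (graph_input n E)"
  obtain t where t: "t \<le> run_cost n (Suc L)" "pc (?run t) = 74"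
      "out (?run t) = filter (\<lambda>x. x \<in> selected) [0..<n]"
    and before: "\<And>i. i < t \<Longrightarrow> \<not> halted prog (?run i) \<and> touched (prog ! pc (?run i)) (?run i) \<subseteq> {..<m}"
    using reach_start unfolding reach_def run_def Let_def by blast
  have "cells_used prog wl (graph_input n E) t \<subseteq> {..<m}"
    unfolding cells_used_def using before by blast
  then have "(LEAST m. cells_used prog wl (graph_input n E) t \<subseteq> {..<m}) \<le> m" by (rule Least_le)
  then show ?thesis
    using t before unfolding computes_def by (auto simp: halted_def length_prog)
qed

end

section \<open>Choice of parameters and asymptotic bounds\<close>

lemma ram_floor_log:
  assumes "simple_graph {..<n} E"
  shows "ram n E (word_length 6 n) (18 + 4 * Suc (floor_log n)) (Suc (floor_log n))"
proof
  \<comment> \<open>With \<open>n < b\<close> and \<open>b ^ 6\<close> values per word, the factor 6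
    leaves the slack \<open>16 * b\<^sup>2 \<le> b ^ 6\<close> even for
    \<open>b = 2\<close>.\<close>
  define b :: nat where "b = 2 ^ Suc (floor_log n)"
  have n: "n < b" unfolding b_def
    by (cases "n = 0") (simp_all add: floor_log_exp2_gt)
  have fl: "Suc (floor_log n) \<le> b" unfolding b_def by (rule less_imp_le) (rule less_exp)
  have b: "2 \<le> b" by (simp add: b_def)
  have w: "2 ^ word_length 6 n = b ^ 6"
    by (simp only: word_length_def b_def flip: power_mult) (simp add: mult.commute)
  have "2 ^ 4 \<le> b ^ 4" using b by (rule power_mono) simp
  then have "16 * b\<^sup>2 \<le> b ^ 4 * b\<^sup>2" by (intro mult_right_mono) simp_all
  then have b6: "16 * b\<^sup>2 \<le> b ^ 6" by (simp flip: power_add)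
  have bb: "2 * b \<le> b\<^sup>2" using b by (simp add: power2_eq_square)
  have "Suc n * Suc n \<le> b * b" using n by (intro mult_le_mono) auto
  then have "n * n + 2 * n + 1 \<le> b\<^sup>2" by (simp add: power2_eq_square)
  then show "n * n + 2 * n + 2 \<le> 2 ^ word_length 6 n" using w b6 bb b by linarith
  have "18 + 4 * Suc (floor_log n) \<le> 18 + 4 * b" using fl by (intro add_left_mono mult_le_mono2)
  also have "\<dots> < 16 * b\<^sup>2" using bb b by linarith
  also have "\<dots> \<le> 2 ^ word_length 6 n" using w b6 by simp
  finally show "18 + 4 * Suc (floor_log n) < 2 ^ word_length 6 n" .
  show "n \<le> 2 ^ Suc (floor_log n)" using n by (simp add: b_def)
qed (rule assms refl)+

text \<open>For \<open>n = 0\<close> both sides are 0 by convention, so the space bound needs no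
  exception.\<close>

lemma floor_log_le_log: "real (floor_log n) \<le> log 2 (real n)"
  by (cases "n = 0") (auto simp: floor_log_altdef log_def)

theorem theorem7:
  shows "\<exists>(P :: program) (k :: nat) (T :: nat \<Rightarrow> real) (e :: nat \<Rightarrow> real)
            (S :: nat \<Rightarrow> real) (\<rho> :: nat \<Rightarrow> real).
    e \<in> O(\<lambda>n. ln (real n)) \<and> (\<forall>\<^sub>F n in sequentially. T n \<le> real n powr e n) \<and>
    S \<in> O(\<lambda>n. (ln (real n))\<^sup>2) \<and>
    \<rho> \<in> O(\<lambda>d. (real d)\<^sup>2) \<and>
    (\<forall>n E d. simple_graph {..<n} E \<and> degenerate d {..<n} E \<longrightarrow>
      (\<exists>ys t b.
         computes P (word_length k n) (graph_input n E) ys t b \<and>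
         real t \<le> T n \<and> real b \<le> S n \<and>
         distinct ys \<and> dominating_set {..<n} E (set ys) \<and>
         real (card (set ys)) \<le> \<rho> d * real (domination_number {..<n} E)))"
proof -
  \<comment> \<open>In \<open>run_cost_le\<close>, the depth \<open>d = floor_log n + 2\<close>
    turns \<open>5 * d + 3\<close> into \<open>5 * floor_log n + 13\<close>. The factors of
    \<open>?S\<close> are the word length and the number of cells, with
    \<open>log 2 (real n)\<close> in place of \<open>floor_log n\<close>.\<close>
  let ?e = "\<lambda>n::nat. 5 * log 2 (real n) + 13"
  let ?S = "\<lambda>n::nat. (6 * (log 2 (real n) + 1)) * (22 + 4 * log 2 (real n))"
  let ?T = "\<lambda>n. real (run_cost n (Suc (Suc (floor_log n))))"
  show ?thesis
  proof (rule exI[of _ prog], rule exI[of _ 6], rule exI[of _ ?T], rule exI[of _ ?e], rule exI[of _ ?S],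
      rule exI[of _ "\<lambda>d. real (8 * d + 4)"], intro conjI allI impI)
  show "?e \<in> O(\<lambda>n. ln (real n))" by real_asymp
  show "?S \<in> O(\<lambda>n. (ln (real n))\<^sup>2)" by real_asymp
  show "(\<lambda>d. real (8 * d + 4)) \<in> O(\<lambda>d. (real d)\<^sup>2)" by real_asymp
  show "\<forall>\<^sub>F n in sequentially. ?T n \<le> real n powr ?e n"
    using eventually_ge_at_top[of 50]
  proof eventually_elim
    case (elim n)
    have "?T n \<le> real (n ^ (5 * floor_log n + 13))"
      using run_cost_le[OF elim, of "Suc (Suc (floor_log n))"] by (simp only: of_nat_le_iff) (simp add: add.commute)
    also have "\<dots> = real n powr real (5 * floor_log n + 13)" using elim by (subst powr_realpow) simp_all
    also have "\<dots> \<le> real n powr ?e n" using elim floor_log_le_log[of n] by (intro powr_mono) auto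
    finally show ?case .
  qed
  fix n d :: nat and E :: "nat set set"
  assume a: "simple_graph {..<n} E \<and> degenerate d {..<n} E"
  interpret ram n E "word_length 6 n" "18 + 4 * Suc (floor_log n)" "Suc (floor_log n)"
    using a ram_floor_log by blast
  let ?ys = "filter (\<lambda>x. x \<in> selected) [0..<n]"
  have dom: "dominating_set {..<n} E selected" unfolding selected_def by (rule dominating_sel)
  then have ys: "set ?ys = selected" by (auto simp: dominating_set_def)
  obtain t b where tb: "t \<le> run_cost n (Suc (Suc (floor_log n)))"
    "b \<le> word_length 6 n * (18 + 4 * Suc (floor_log n))"
    "computes prog (word_length 6 n) (graph_input n E) ?ys t b"
    using computes_selected by blast
  have "real b \<le> real (word_length 6 n * (18 + 4 * Suc (floor_log n)))"
    using tb(2) by (simp only: of_nat_le_iff)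
  also have "\<dots> = (6 * (real (floor_log n) + 1)) * (22 + 4 * real (floor_log n))"
    by (simp add: word_length_def)
  also have "\<dots> \<le> ?S n"
    using floor_log_le_log[of n] by (intro mult_mono) auto
  finally have b: "real b \<le> ?S n" .
  have card: "real (card (set ?ys)) \<le> real (8 * d + 4) * real (domination_number {..<n} E)"
    using card_sel_le_domination_number[of d] a unfolding ys unfolding selected_def
    by (simp only: of_nat_le_iff flip: of_nat_mult)
  show "\<exists>ys t b. computes prog (word_length 6 n) (graph_input n E) ys t b \<and>
      real t \<le> ?T n \<and> real b \<le> ?S n \<and>
      distinct ys \<and> dominating_set {..<n} E (set ys) \<and>
      real (card (set ys)) \<le> real (8 * d + 4) * real (domination_number {..<n} E)"
    using tb b card dom ys by (intro exI[of _ ?ys] exI[of _ t] exI[of _ b] conjI) simp_all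
  qed
qed

end
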